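(* Let $(\mathcal X,d,m,\mathcal E,\mathcal F^m)$ be a length MMD space which satisfies Assumption (Green) and the elliptic Harnack inequality (EHI). Then $(\mathcal X,d)$ satisfies the metric doubling property: there exists $M<\infty$ such that every ball $B(x,R)$, $x\in\mathcal X$, $R>0$, can be covered by $M$ balls of radius $R/2$.
   Context: MMD space: $(\mathcal X,d)$ is a complete, locally compact, separable metric space with $\mathcal X\setminus B(x,R)\neq\emptyset$ for all $x\in\mathcal X$, $R>0$, where $B(x,r)=\{y:d(x,y)<r\}$; $m$ is a Radon measure on $\mathcal X$ with $m(U)>0$ for every non-empty open $U$; $(\mathcal E,\mathcal F^m)$ is a strongly local regular Dirichlet form on $L^2(\mathcal X,m)$. It is a length MMD space if $d(x,y)$ is always the infimum of the lengths of curves joining $x$ and $y$. Notation: $\mathcal C_0(D)$ is the space of continuous functions with compact support in $D$; $A\Subset D$ means that the closure of $A$ is a compact subset of $D$. For non-empty open $D$, $\mathcal F_D$ is the closure of $\mathcal F^m\cap\mathcal C_0(D)$ in the norm $(\mathcal E(f,f)+\|f\|_2^2)^{1/2}$. Harmonic functions: for open $U$, $\mathcal F_{\mathrm{loc}}(U)$ is the set of $h\in L^2_{\mathrm{loc}}(U)$ such that for every relatively compact $V\subset U$ there is $h^\#\in\mathcal F^m$ with $h=h^\#$ $m$-a.e. on $V$. $h:U\to\mathbb R$ is harmonic in $U$ if $h\in\mathcal F_{\mathrm{loc}}(U)$ and $\mathcal E(f,h)=0$ for all $f\in\mathcal F^m\cap\mathcal C_0(U)$, where $\mathcal E(f,h):=\mathcal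 E(f,h^\#)$ for any $h^\#\in\mathcal F^m$ equal to $h$ on a precompact open set containing $\operatorname{supp} f$. EHI: there exist constants $1<A,C_H<\infty$ such that for all $x\in\mathcal X$, $R>0$ and every nonnegative harmonic $h$ on $B(x,AR)$, $\operatorname{ess\,sup}_{B(x,R)}h\le C_H\operatorname{ess\,inf}_{B(x,R)}h$. Assumption (Green): for every bounded non-empty open $D\subset\mathcal X$, $\lambda_{\min}(D)=\inf_{f\in\mathcal F_D\setminus\{0\}}\mathcal E(f,f)/\|f\|_2^2>0$, and, with $\mathcal L_D$ the generator of $(\mathcal E,\mathcal F_D)$ on $L^2(D,m)$ and $G_D=(-\mathcal L_D)^{-1}$, there is a jointly measurable $g_D:D\times D\to\mathbb R$ with $G_Df(x)=\int_D g_D(x,y)f(y)\,m(dy)$ for all $f\in L^2(D,m)$ and $m$-a.e. $x\in D$, such that, with $\operatorname{diag}$ the diagonal of $D\times D$: (i) $g_D(x,y)=g_D(y,x)\ge0$ off $\operatorname{diag}$; (ii) $g_D$ is jointly continuous on $D\times D\setminus\operatorname{diag}$; (iii) if $x_0\in U\Subset D$ with $U$ open then $\inf_{U\setminus\{x_0\}}g_D(x_0,\cdot)=\inf_{\partial U}g_D(x_0,\cdot)$ and $\sup_{D\setminus U}g_D(x_0,\cdot)=\sup_{\partial U}g_D(x_0,\cdot)$; (iv) for each $x\in D$, $y\mapsto g_D(x,y)$ is in $\mathcal F_{\mathrm{loc}}(D\setminus\{x\})$ and harmonic in $D\setminus\{x\}$. *)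

theory Defs
  imports "HOL-Analysis.Analysis" "HOL-Probability.Essential_Supremum"
begin

text \<open>The space is a type of class \<open>polish_space\<close> (complete separable metric space). Elements of
  L2 spaces are represented by Borel measurable functions; the domain \<open>F\<close> of a form is closed under
  m-a.e. equality, and the form \<open>E\<close> respects it. Values of \<open>E\<close> outside \<open>F\<close> are irrelevant.\<close>

definition compactly_in :: "'a::topological_space set \<Rightarrow> 'a set \<Rightarrow> bool" (infix "\<Subset>" 50) where
  "A \<Subset> D \<longleftrightarrow> compact (closure A) \<and> closure A \<subseteq> D"

definition C0 :: "'a::topological_space set \<Rightarrow> ('a \<Rightarrow> real) set" where
  "C0 D = {f. continuous_on UNIV f \<and> {x. f x \<noteq> 0} \<Subset> D}"

definition radon_measure :: "'a::topological_space measure \<Rightarrow> bool" where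
  "radon_measure m \<longleftrightarrow>
     sets m = sets borel \<and>
     (\<forall>K. compact K \<longrightarrow> emeasure m K < \<infinity>) \<and>
     (\<forall>B\<in>sets m. emeasure m B = (INF U\<in>{U. open U \<and> B \<subseteq> U}. emeasure m U)) \<and>
     (\<forall>U. open U \<longrightarrow> emeasure m U = (SUP K\<in>{K. compact K \<and> K \<subseteq> U}. emeasure m K))"


subsection \<open>Dirichlet forms\<close>

definition L2 :: "'a measure \<Rightarrow> ('a \<Rightarrow> real) set" where
  "L2 m = {f \<in> borel_measurable m. integrable m (\<lambda>x. (f x)\<^sup>2)}"

definition norm2 :: "'a measure \<Rightarrow> ('a \<Rightarrow> real) \<Rightarrow> real" where
  "norm2 m f = sqrt (\<integral>x. (f x)\<^sup>2 \<partial>m)"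

text \<open>L2(D,m), each function being extended by 0 outside \<open>D\<close>.\<close>

definition L2_on :: "'a measure \<Rightarrow> 'a set \<Rightarrow> ('a \<Rightarrow> real) set" where
  "L2_on m D = {f \<in> L2 m. AE x in m. x \<notin> D \<longrightarrow> f x = 0}"

type_synonym 'a form = "('a \<Rightarrow> real) \<Rightarrow> ('a \<Rightarrow> real) \<Rightarrow> real"

definition E1_norm :: "'a measure \<Rightarrow> 'a form \<Rightarrow> ('a \<Rightarrow> real) \<Rightarrow> real" where
  "E1_norm m E f = sqrt (E f f + (norm2 m f)\<^sup>2)"

definition dirichlet_form :: "'a measure \<Rightarrow> 'a form \<Rightarrow> ('a \<Rightarrow> real) set \<Rightarrow> bool" where
  "dirichlet_form m E F \<longleftrightarrow>
     F \<subseteq> L2 m \<and>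
     (\<forall>f\<in>F. \<forall>g\<in>borel_measurable m. (AE x in m. f x = g x) \<longrightarrow> g \<in> F \<and> (\<forall>h\<in>F. E g h = E f h)) \<and>
     \<comment> \<open>dense linear subspace\<close>
     (\<forall>f\<in>F. \<forall>g\<in>F. (\<lambda>x. f x + g x) \<in> F) \<and>
     (\<forall>f\<in>F. \<forall>c. (\<lambda>x. c * f x) \<in> F) \<and>
     (\<forall>f\<in>L2 m. \<forall>e>0. \<exists>g\<in>F. norm2 m (\<lambda>x. f x - g x) < e) \<and>
     \<comment> \<open>nonnegative definite symmetric bilinear form\<close>
     (\<forall>f\<in>F. \<forall>g\<in>F. E f g = E g f) \<and>
     (\<forall>f\<in>F. \<forall>g\<in>F. \<forall>h\<in>F. E (\<lambda>x. f x + g x) h = E f h + E g h) \<and>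
     (\<forall>f\<in>F. \<forall>h\<in>F. \<forall>c. E (\<lambda>x. c * f x) h = c * E f h) \<and>
     (\<forall>f\<in>F. 0 \<le> E f f) \<and>
     \<comment> \<open>closed\<close>
     (\<forall>u :: nat \<Rightarrow> 'a \<Rightarrow> real. (\<forall>n. u n \<in> F) \<longrightarrow>
        (\<forall>e>0. \<exists>N. \<forall>i\<ge>N. \<forall>j\<ge>N. E1_norm m E (\<lambda>x. u i x - u j x) < e) \<longrightarrow>
        (\<exists>f\<in>F. (\<lambda>n. E1_norm m E (\<lambda>x. u n x - f x)) \<longlonglongrightarrow> 0)) \<and>
     \<comment> \<open>Markovian\<close>
     (\<forall>f\<in>F. (\<lambda>x. min (max (f x) 0) 1) \<in> F \<and>
        E (\<lambda>x. min (max (f x) 0) 1) (\<lambda>x. min (max (f x) 0) 1) \<le> E f f)"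

definition regular_form ::
    "'a::topological_space measure \<Rightarrow> 'a form \<Rightarrow> ('a \<Rightarrow> real) set \<Rightarrow> bool" where
  "regular_form m E F \<longleftrightarrow>
     (\<forall>f\<in>F. \<forall>e>0. \<exists>g\<in>F \<inter> C0 UNIV. E1_norm m E (\<lambda>x. f x - g x) < e) \<and>
     (\<forall>f\<in>C0 UNIV. \<forall>e>0. \<exists>g\<in>F \<inter> C0 UNIV. \<forall>x. \<bar>f x - g x\<bar> < e)"

text \<open>Support of an element of L2, that is, of the measure \<open>f dm\<close>.\<close>

definition ess_support :: "'a::topological_space measure \<Rightarrow> ('a \<Rightarrow> real) \<Rightarrow> 'a set" where
  "ess_support m f = - \<Union>{U. open U \<and> (AE x in m. x \<in> U \<longrightarrow> f x = 0)}"

definition strongly_local ::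
    "'a::topological_space measure \<Rightarrow> 'a form \<Rightarrow> ('a \<Rightarrow> real) set \<Rightarrow> bool" where
  "strongly_local m E F \<longleftrightarrow>
     (\<forall>f\<in>F. \<forall>g\<in>F. compact (ess_support m f) \<longrightarrow> compact (ess_support m g) \<longrightarrow>
        (\<exists>U c. open U \<and> ess_support m g \<subseteq> U \<and> (AE x in m. x \<in> U \<longrightarrow> f x = c)) \<longrightarrow>
        E f g = 0)"


subsection \<open>Metric measure Dirichlet spaces\<close>

definition mmd_space ::
    "'a::polish_space measure \<Rightarrow> 'a form \<Rightarrow> ('a \<Rightarrow> real) set \<Rightarrow> bool" where
  "mmd_space m E F \<longleftrightarrow>
     locally_compact_space (euclidean :: 'a topology) \<and>
     (\<forall>(x::'a) R. R > 0 \<longrightarrow> UNIV - ball x R \<noteq> {}) \<and>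
     radon_measure m \<and> (\<forall>U. open U \<and> U \<noteq> {} \<longrightarrow> emeasure m U > 0) \<and>
     dirichlet_form m E F \<and> regular_form m E F \<and> strongly_local m E F"

definition path_length :: "(real \<Rightarrow> 'a::metric_space) \<Rightarrow> ennreal" where
  "path_length \<gamma> =
     (SUP (n, t) \<in> {(n::nat, t). mono_on {..n} t \<and> t ` {..n} \<subseteq> {0..1}}.
        \<Sum>i<n. ennreal (dist (\<gamma> (t i)) (\<gamma> (t (Suc i)))))"

definition length_mmd_space ::
    "'a::polish_space measure \<Rightarrow> 'a form \<Rightarrow> ('a \<Rightarrow> real) set \<Rightarrow> bool" where
  "length_mmd_space m E F \<longleftrightarrow>
     mmd_space m E F \<and>
     (\<forall>x y :: 'a. ennreal (dist x y) =
        (INF \<gamma> \<in> {\<gamma>. path \<gamma> \<and> pathstart \<gamma> = x \<and> pathfinish \<gamma> = y}. path_length \<gamma>))"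


subsection \<open>Harmonic functions and the elliptic Harnack inequality\<close>

definition L2_loc :: "'a::topological_space measure \<Rightarrow> 'a set \<Rightarrow> ('a \<Rightarrow> real) set" where
  "L2_loc m U = {h \<in> borel_measurable (restrict_space m U).
     \<forall>K. compact K \<and> K \<subseteq> U \<longrightarrow> set_integrable m K (\<lambda>x. (h x)\<^sup>2)}"

text \<open>Relatively compact subsets of \<open>U\<close> are understood relative to \<open>U\<close>: their closure is a compact
  subset of \<open>U\<close>.\<close>

definition F_loc :: "'a::topological_space measure \<Rightarrow> ('a \<Rightarrow> real) set \<Rightarrow> 'a set \<Rightarrow> ('a \<Rightarrow> real) set"
  where
  "F_loc m F U = {h \<in> L2_loc m U. \<forall>V. V \<Subset> U \<longrightarrow> (\<exists>h'\<in>F. AE x in m. x \<in> V \<longrightarrow> h x = h' x)}"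

definition harmonic ::
    "'a::topological_space measure \<Rightarrow> 'a form \<Rightarrow> ('a \<Rightarrow> real) set \<Rightarrow> 'a set \<Rightarrow> ('a \<Rightarrow> real) \<Rightarrow> bool"
  where
  "harmonic m E F U h \<longleftrightarrow>
     h \<in> F_loc m F U \<and>
     (\<forall>f\<in>F \<inter> C0 U. \<forall>V. \<forall>h'\<in>F.
        open V \<and> V \<Subset> U \<and> closure {x. f x \<noteq> 0} \<subseteq> V \<and> (AE x in m. x \<in> V \<longrightarrow> h x = h' x) \<longrightarrow>
        E f h' = 0)"

definition essinf :: "'a measure \<Rightarrow> ('a \<Rightarrow> ereal) \<Rightarrow> ereal" where
  "essinf M f = - esssup M (\<lambda>x. - f x)"

definition EHI :: "'a::metric_space measure \<Rightarrow> 'a form \<Rightarrow> ('a \<Rightarrow> real) set \<Rightarrow> bool" where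
  "EHI m E F \<longleftrightarrow>
     (\<exists>A C :: real. 1 < A \<and> 1 < C \<and>
        (\<forall>x R h. 0 < R \<longrightarrow> harmonic m E F (ball x (A * R)) h \<longrightarrow>
           (\<forall>y\<in>ball x (A * R). 0 \<le> h y) \<longrightarrow>
           esssup (restrict_space m (ball x R)) (\<lambda>y. ereal (h y))
             \<le> ereal C * essinf (restrict_space m (ball x R)) (\<lambda>y. ereal (h y))))"


subsection \<open>Green functions\<close>

definition F_on ::
    "'a::topological_space measure \<Rightarrow> 'a form \<Rightarrow> ('a \<Rightarrow> real) set \<Rightarrow> 'a set \<Rightarrow> ('a \<Rightarrow> real) set" where
  "F_on m E F D = {f \<in> F. \<forall>e>0. \<exists>g\<in>F \<inter> C0 D. E1_norm m E (\<lambda>x. f x - g x) < e}"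

definition lambda_min ::
    "'a::topological_space measure \<Rightarrow> 'a form \<Rightarrow> ('a \<Rightarrow> real) set \<Rightarrow> 'a set \<Rightarrow> ereal" where
  "lambda_min m E F D =
     (INF f \<in> {f \<in> F_on m E F D. norm2 m f \<noteq> 0}. ereal (E f f / (norm2 m f)\<^sup>2))"

text \<open>Graph of the generator of \<open>(E, F_D)\<close> on L2(D,m); both components are determined up to
  m-a.e. equality only. The Green operator is the inverse of minus the generator.\<close>

definition generator ::
    "'a::topological_space measure \<Rightarrow> 'a form \<Rightarrow> ('a \<Rightarrow> real) set \<Rightarrow> 'a set \<Rightarrow>
     (('a \<Rightarrow> real) \<times> ('a \<Rightarrow> real)) set" where
  "generator m E F D = {(u, w). u \<in> F_on m E F D \<and> w \<in> L2_on m D \<and>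
     (\<forall>v\<in>F_on m E F D. E u v = - (\<integral>x. w x * v x \<partial>m))}"

definition green_operator ::
    "'a::topological_space measure \<Rightarrow> 'a form \<Rightarrow> ('a \<Rightarrow> real) set \<Rightarrow> 'a set \<Rightarrow>
     (('a \<Rightarrow> real) \<times> ('a \<Rightarrow> real)) set" where
  "green_operator m E F D = {(f, u). (u, \<lambda>x. - f x) \<in> generator m E F D}"

definition green_function ::
    "'a::polish_space measure \<Rightarrow> 'a form \<Rightarrow> ('a \<Rightarrow> real) set \<Rightarrow> 'a set \<Rightarrow>
     ('a \<Rightarrow> 'a \<Rightarrow> real) \<Rightarrow> bool" where
  "green_function m E F D g \<longleftrightarrow>
     (\<lambda>(x, y). g x y) \<in> borel_measurable (restrict_space borel (D \<times> D)) \<and>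
     (\<forall>f\<in>L2_on m D. \<forall>u. (f, u) \<in> green_operator m E F D \<longrightarrow>
        (AE x in m. x \<in> D \<longrightarrow>
           set_integrable m D (\<lambda>y. g x y * f y) \<and> u x = (LINT y:D|m. g x y * f y))) \<and>
     (\<forall>x\<in>D. \<forall>y\<in>D. x \<noteq> y \<longrightarrow> g x y = g y x \<and> 0 \<le> g x y) \<and>
     continuous_on (D \<times> D - {(x, x) | x. x \<in> D}) (\<lambda>(x, y). g x y) \<and>
     (\<forall>x\<^sub>0 U. open U \<and> x\<^sub>0 \<in> U \<and> U \<Subset> D \<longrightarrow>
        (INF y \<in> U - {x\<^sub>0}. ereal (g x\<^sub>0 y)) = (INF y \<in> frontier U. ereal (g x\<^sub>0 y)) \<and>
        (SUP y \<in> D - U. ereal (g x\<^sub>0 y)) = (SUP y \<in> frontier U. ereal (g x\<^sub>0 y))) \<and>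
     (\<forall>x\<in>D. g x \<in> F_loc m F (D - {x}) \<and> harmonic m E F (D - {x}) (g x))"

definition green_assumption ::
    "'a::polish_space measure \<Rightarrow> 'a form \<Rightarrow> ('a \<Rightarrow> real) set \<Rightarrow> bool" where
  "green_assumption m E F \<longleftrightarrow>
     (\<forall>D. bounded D \<and> open D \<and> D \<noteq> {} \<longrightarrow>
        lambda_min m E F D > 0 \<and> (\<exists>g. green_function m E F D g))"

end

theory Submission
  imports Defs
begin

text \<open>
  The main point is that a sphere of radius \<open>\<rho>\<close> around \<open>x0\<close> carries a
  bounded number of points whose mutual distances are at least a fixed fraction of
  \<open>\<rho>\<close> (\<open>separated_on_sphere_card\<close>). Given this, a maximal separated
  set on each of four concentric spheres, together with the centre, provides the covering of a
  ball: in a length space every point of the ball is near the centre or near one of these spheres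
  (\<open>ball_cover\<close>).

  Let the separation be \<open>40 t\<close>, place the obstacle \<open>cball z (2 * t)\<close>
  around each point \<open>z\<close> of a finite separated set \<open>Z\<close> on the sphere, and
  let \<open>h z\<close> be the harmonic measure of the obstacle of \<open>z\<close>: the function
  with zero boundary values on \<open>ball x0 (2 * \<rho>)\<close> that is \<open>1\<close> on
  this obstacle, \<open>0\<close> on the others, and harmonic elsewhere. The functions
  \<open>h z\<close> are nonnegative and their sum is at most \<open>1\<close>. So it suffices to
  bound each of them below near \<open>x0\<close> by a constant depending only on the constants of
  the Harnack inequality.

  At a point \<open>y\<close> with distance about \<open>4 t\<close> from \<open>z\<close> such a
  bound comes from comparing \<open>h z\<close> with a normalised Green potential \<open>v\<close>
  of \<open>ball z (16 * t)\<close>, which does not meet the other obstacles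
  (\<open>harmonic_ge_bump\<close>). That \<open>v\<close> is at most \<open>1\<close> off
  \<open>ball z t\<close> and bounded below near \<open>y\<close> (\<open>bump_exists\<close>)
  expresses that the value at \<open>y\<close> of the Green function with pole \<open>z\<close>
  dominates, up to a constant, its values on the sphere of radius \<open>t\<close> around
  \<open>z\<close>. This is proved with Harnack chains along almost geodesics and the symmetry of
  the Green function, the pole being moved when a chain would pass too near to it
  (\<open>green_sphere\<close>); the maximum principle then gives the bound on the whole exterior
  of \<open>ball z t\<close>. Finally \<open>y\<close> is chosen almost on a geodesic from
  \<open>x0\<close> to \<open>z\<close>. Since all centres of obstacles are at distance
  \<open>\<rho>\<close> from \<open>x0\<close>, the way from \<open>y\<close> to \<open>x0\<close>
  avoids all obstacles, and a Harnack chain carries the lower bound to \<open>x0\<close>.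

  Harmonic measures and potentials are constructed in the Hilbert space of the form by the Riesz
  representation. Lattice properties of the form domain and the extension of strong locality to
  functions without compact support all rest on one closure property: an \<open>L2\<close> limit
  of elements of a convex set with bounded energy belongs to the closure of this set in the form
  norm (\<open>weak_closure\<close>).
\<close>

section \<open>Semidefinite forms and the space L2\<close>

text \<open>A positive semidefinite symmetric bilinear form on a linear space of real functions. It is used
  twice: for the \<open>L2\<close> product and for the Dirichlet form.\<close>

locale psd_form =
  fixes V :: "('a \<Rightarrow> real) set" and B :: "('a \<Rightarrow> real) \<Rightarrow> ('a \<Rightarrow> real) \<Rightarrow> real"
  assumes add_closed: "f \<in> V \<Longrightarrow> g \<in> V \<Longrightarrow> (\<lambda>x. f x + g x) \<in> V"
    and scale_closed: "f \<in> V \<Longrightarrow> (\<lambda>x. c * f x) \<in> V"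
    and sym: "f \<in> V \<Longrightarrow> g \<in> V \<Longrightarrow> B f g = B g f"
    and add_left: "f \<in> V \<Longrightarrow> g \<in> V \<Longrightarrow> h \<in> V \<Longrightarrow> B (\<lambda>x. f x + g x) h = B f h + B g h"
    and scale_left: "f \<in> V \<Longrightarrow> h \<in> V \<Longrightarrow> B (\<lambda>x. c * f x) h = c * B f h"
    and nonneg: "f \<in> V \<Longrightarrow> 0 \<le> B f f"
begin

lemma diff_closed: "f \<in> V \<Longrightarrow> g \<in> V \<Longrightarrow> (\<lambda>x. f x - g x) \<in> V"
  using add_closed[of f "\<lambda>x. (-1) * g x"] scale_closed[of g "-1"] by simp

lemma mid_closed: "f \<in> V \<Longrightarrow> g \<in> V \<Longrightarrow> (\<lambda>x. (f x + g x) / 2) \<in> V"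
  using scale_closed[OF add_closed[of f g], of "1/2"] by simp

lemma diff_left: "f \<in> V \<Longrightarrow> g \<in> V \<Longrightarrow> h \<in> V \<Longrightarrow> B (\<lambda>x. f x - g x) h = B f h - B g h"
  using add_left[of f "\<lambda>x. (-1) * g x" h] scale_closed[of g "-1"] scale_left[of g h "-1"] by simp

lemma add_right: "f \<in> V \<Longrightarrow> g \<in> V \<Longrightarrow> h \<in> V \<Longrightarrow> B h (\<lambda>x. f x + g x) = B h f + B h g"
  by (simp add: add_left add_closed sym[of h])

lemma diff_right: "f \<in> V \<Longrightarrow> g \<in> V \<Longrightarrow> h \<in> V \<Longrightarrow> B h (\<lambda>x. f x - g x) = B h f - B h g"
  by (simp add: diff_left diff_closed sym[of h])

lemma scale_right: "f \<in> V \<Longrightarrow> h \<in> V \<Longrightarrow> B h (\<lambda>x. c * f x) = c * B h f"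
  by (simp add: scale_left scale_closed sym[of h])

lemma add_self: "f \<in> V \<Longrightarrow> g \<in> V \<Longrightarrow> B (\<lambda>x. f x + g x) (\<lambda>x. f x + g x) = B f f + 2 * B f g + B g g"
  by (simp add: add_left add_right add_closed sym[of g f])

lemma diff_self: "f \<in> V \<Longrightarrow> g \<in> V \<Longrightarrow> B (\<lambda>x. f x - g x) (\<lambda>x. f x - g x) = B f f - 2 * B f g + B g g"
  by (simp add: diff_left diff_right diff_closed sym[of g f])

lemma scale_self: "f \<in> V \<Longrightarrow> B (\<lambda>x. c * f x) (\<lambda>x. c * f x) = c\<^sup>2 * B f f"
  by (simp add: scale_left scale_right scale_closed power2_eq_square)

lemma mid_left: "f \<in> V \<Longrightarrow> g \<in> V \<Longrightarrow> h \<in> V \<Longrightarrow> B (\<lambda>x. (f x + g x) / 2) h = (B f h + B g h) / 2"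
  using scale_left[OF add_closed[of f g], of h "1/2"] by (simp add: add_left)

lemma mid_right: "f \<in> V \<Longrightarrow> g \<in> V \<Longrightarrow> h \<in> V \<Longrightarrow> B h (\<lambda>x. (f x + g x) / 2) = (B h f + B h g) / 2"
  by (simp add: mid_left mid_closed sym[of h])

lemma mid_self: "f \<in> V \<Longrightarrow> g \<in> V \<Longrightarrow>
    B (\<lambda>x. (f x + g x) / 2) (\<lambda>x. (f x + g x) / 2) = (B f f + 2 * B f g + B g g) / 4"
  by (simp add: mid_left mid_right mid_closed sym[of g f] field_simps)

lemma parallelogram: "f \<in> V \<Longrightarrow> g \<in> V \<Longrightarrow>
    B (\<lambda>x. f x - g x) (\<lambda>x. f x - g x)
      = 2 * B f f + 2 * B g g - 4 * B (\<lambda>x. (f x + g x) / 2) (\<lambda>x. (f x + g x) / 2)"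
  by (simp add: diff_self mid_self field_simps)

lemma mid_le: "f \<in> V \<Longrightarrow> g \<in> V \<Longrightarrow>
    B (\<lambda>x. (f x + g x) / 2) (\<lambda>x. (f x + g x) / 2) \<le> (B f f + B g g) / 2"
  using nonneg[OF diff_closed[of f g]] by (simp add: diff_self mid_self)

lemma diff_self_le: "f \<in> V \<Longrightarrow> g \<in> V \<Longrightarrow>
    B (\<lambda>x. f x - g x) (\<lambda>x. f x - g x) \<le> 2 * B f f + 2 * B g g"
  using nonneg[OF add_closed[of f g]] by (simp add: diff_self add_self)

lemma add_self_le: "f \<in> V \<Longrightarrow> g \<in> V \<Longrightarrow>
    B (\<lambda>x. f x + g x) (\<lambda>x. f x + g x) \<le> 2 * B f f + 2 * B g g"
  using nonneg[OF diff_closed[of f g]] by (simp add: diff_self add_self)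

lemma cauchy_schwarz:
  assumes "f \<in> V" "g \<in> V" shows "(B f g)\<^sup>2 \<le> B f f * B g g"
proof -
  have q: "0 \<le> B f f - 2 * c * B f g + c\<^sup>2 * B g g" for c
    using nonneg[OF diff_closed[OF assms(1) scale_closed[OF assms(2), of c]]] assms
    by (simp add: diff_self scale_closed scale_self scale_right)
  show ?thesis
  proof (cases "B g g = 0")
    case True
    have "B f g = 0"
    proof (rule ccontr)
      assume "B f g \<noteq> 0"
      then show False using q[of "(B f f + 1) / (2 * B f g)"] True by simp
    qed
    then show ?thesis using True by simp
  next
    case False
    then have pos: "B g g > 0" using nonneg[OF assms(2)] by simp
    have "0 \<le> B f f - (B f g)\<^sup>2 / B g g"
      using q[of "B f g / B g g"] pos by (simp add: power2_eq_square field_simps)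
    then show ?thesis using pos by (simp add: field_simps)
  qed
qed

lemma cauchy_schwarz_sqrt: "f \<in> V \<Longrightarrow> g \<in> V \<Longrightarrow> \<bar>B f g\<bar> \<le> sqrt (B f f) * sqrt (B g g)"
  using real_sqrt_le_mono[OF cauchy_schwarz[of f g]] by (simp add: real_sqrt_mult)

lemma triangle_sqrt:
  assumes "f \<in> V" "g \<in> V"
  shows "sqrt (B (\<lambda>x. f x + g x) (\<lambda>x. f x + g x)) \<le> sqrt (B f f) + sqrt (B g g)"
proof (rule real_le_lsqrt)
  show "0 \<le> sqrt (B f f) + sqrt (B g g)" using assms nonneg by simp
  show "B (\<lambda>x. f x + g x) (\<lambda>x. f x + g x) \<le> (sqrt (B f f) + sqrt (B g g))\<^sup>2"
    using assms cauchy_schwarz_sqrt[of f g] nonneg[of f] nonneg[of g]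
    by (simp add: add_self power2_sum)
qed

end

text \<open>The squared \<open>L2\<close> seminorm; working with squares, the parallelogram law replaces the
  triangle inequality nearly everywhere.\<close>

definition nsq :: "'a measure \<Rightarrow> ('a \<Rightarrow> real) \<Rightarrow> real" where
  "nsq m f = (\<integral>x. (f x)\<^sup>2 \<partial>m)"

lemma nsq_nonneg [simp]: "0 \<le> nsq m f"
  unfolding nsq_def by simp

lemma norm2_power2: "(norm2 m f)\<^sup>2 = nsq m f"
  unfolding norm2_def nsq_def by simp

lemma L2_measurable [measurable_dest]: "f \<in> L2 m \<Longrightarrow> f \<in> borel_measurable m"
  by (simp add: L2_def)

lemma L2_integrable_prod:
  assumes "f \<in> L2 m" "g \<in> L2 m" shows "integrable m (\<lambda>x. f x * g x)"
proof (rule Bochner_Integration.integrable_bound)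
  show "integrable m (\<lambda>x. (f x)\<^sup>2 + (g x)\<^sup>2)" using assms by (simp add: L2_def)
  show "(\<lambda>x. f x * g x) \<in> borel_measurable m" using assms by measurable
  show "AE x in m. norm (f x * g x) \<le> norm ((f x)\<^sup>2 + (g x)\<^sup>2)"
  proof (rule AE_I2)
    fix x
    have "2 * (\<bar>f x\<bar> * \<bar>g x\<bar>) \<le> \<bar>f x\<bar>\<^sup>2 + \<bar>g x\<bar>\<^sup>2"
      using sum_squares_bound[of "\<bar>f x\<bar>" "\<bar>g x\<bar>"] by (simp add: mult.assoc)
    moreover have "0 \<le> \<bar>f x\<bar> * \<bar>g x\<bar>" by simp
    ultimately have "\<bar>f x\<bar> * \<bar>g x\<bar> \<le> \<bar>f x\<bar>\<^sup>2 + \<bar>g x\<bar>\<^sup>2" by linarith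
    then show "norm (f x * g x) \<le> norm ((f x)\<^sup>2 + (g x)\<^sup>2)" by (simp add: abs_mult)
  qed
qed

lemma L2_add: assumes "f \<in> L2 m" "g \<in> L2 m" shows "(\<lambda>x. f x + g x) \<in> L2 m"
  using assms L2_integrable_prod[OF assms] unfolding L2_def by (auto simp: power2_sum mult.assoc)

lemma L2_scale: "f \<in> L2 m \<Longrightarrow> (\<lambda>x. c * f x) \<in> L2 m"
  unfolding L2_def by (auto simp: power_mult_distrib)

lemma psd_form_L2: "psd_form (L2 m) (\<lambda>f g. \<integral>x. f x * g x \<partial>m)"
proof
  fix f g h :: "'a \<Rightarrow> real" and c :: real
  assume f: "f \<in> L2 m"
  show "(\<lambda>x. c * f x) \<in> L2 m" using f by (rule L2_scale)
  show "0 \<le> (\<integral>x. f x * f x \<partial>m)" by simp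
  show "(\<integral>x. (c * f x) * h x \<partial>m) = c * (\<integral>x. f x * h x \<partial>m)" by (simp add: mult.assoc)
  assume g: "g \<in> L2 m"
  show "(\<lambda>x. f x + g x) \<in> L2 m" using f g by (rule L2_add)
  show "(\<integral>x. f x * g x \<partial>m) = (\<integral>x. g x * f x \<partial>m)" by (simp add: mult.commute)
  assume h: "h \<in> L2 m"
  show "(\<integral>x. (f x + g x) * h x \<partial>m) = (\<integral>x. f x * h x \<partial>m) + (\<integral>x. g x * h x \<partial>m)"
    using L2_integrable_prod[OF f h] L2_integrable_prod[OF g h] by (simp add: distrib_right)
qed

interpretation L2: psd_form "L2 m" "\<lambda>f g. \<integral>x. f x * g x \<partial>m" for m :: "'a measure"
  by (rule psd_form_L2)

lemma nsq_alt: "nsq m f = (\<integral>x. f x * f x \<partial>m)"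
  by (simp add: nsq_def power2_eq_square)

lemmas L2_diff = L2.diff_closed
lemmas nsq_diff_le = L2.diff_self_le[folded nsq_alt]
lemmas nsq_add_le = L2.add_self_le[folded nsq_alt]
lemmas nsq_mid_le = L2.mid_le[folded nsq_alt]

lemma L2_bound:
  assumes "f \<in> L2 m" "g \<in> borel_measurable m" "AE x in m. \<bar>g x\<bar> \<le> \<bar>f x\<bar>"
  shows "g \<in> L2 m"
proof -
  have "integrable m (\<lambda>x. (g x)\<^sup>2)"
  proof (rule Bochner_Integration.integrable_bound)
    show "integrable m (\<lambda>x. (f x)\<^sup>2)" using assms by (simp add: L2_def)
    show "(\<lambda>x. (g x)\<^sup>2) \<in> borel_measurable m" using assms by simp
    show "AE x in m. norm ((g x)\<^sup>2) \<le> norm ((f x)\<^sup>2)"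
      using assms(3) by eventually_elim (simp add: abs_le_square_iff)
  qed
  then show ?thesis using assms by (simp add: L2_def)
qed

lemma nsq_mono:
  assumes "f \<in> L2 m" "g \<in> borel_measurable m" "AE x in m. \<bar>g x\<bar> \<le> \<bar>f x\<bar>"
  shows "nsq m g \<le> nsq m f"
  unfolding nsq_def
proof (rule integral_mono_AE)
  show "integrable m (\<lambda>x. (f x)\<^sup>2)" using assms by (simp add: L2_def)
  show "integrable m (\<lambda>x. (g x)\<^sup>2)" using L2_bound[OF assms] by (simp add: L2_def)
  show "AE x in m. (g x)\<^sup>2 \<le> (f x)\<^sup>2"
    using assms(3) by eventually_elim (simp add: abs_le_square_iff)
qed

lemma nsq_cong_AE:
  assumes "f \<in> borel_measurable m" "g \<in> borel_measurable m" "AE x in m. f x = g x"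
  shows "nsq m f = nsq m g"
  unfolding nsq_def using assms by (intro integral_cong_AE) auto

lemma nsq_eq_0:
  assumes "f \<in> L2 m" "nsq m f = 0" shows "AE x in m. f x = 0"
proof -
  have "integrable m (\<lambda>x. (f x)\<^sup>2)" using assms by (simp add: L2_def)
  from integral_nonneg_eq_0_iff_AE[OF this] show ?thesis using assms by (simp add: nsq_def)
qed

section \<open>Energy-bounded limits in a Dirichlet form\<close>

text \<open>The form and its domain, with no topology on the underlying space.\<close>

locale dirichlet =
  fixes m :: "'a measure" and E :: "'a form" and F :: "('a \<Rightarrow> real) set"
  assumes dir: "dirichlet_form m E F"
begin

lemma F_L2: "f \<in> F \<Longrightarrow> f \<in> L2 m"
  using dir by (auto simp: dirichlet_form_def)

lemma F_meas [measurable_dest]: "f \<in> F \<Longrightarrow> f \<in> borel_measurable m"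
  by (simp add: F_L2 L2_measurable)

lemma AE_closed: "\<forall>f\<in>F. \<forall>g\<in>borel_measurable m.
    (AE x in m. f x = g x) \<longrightarrow> g \<in> F \<and> (\<forall>h\<in>F. E g h = E f h)"
  using dir unfolding dirichlet_form_def by (elim conjE)

lemma F_AE_cong: "f \<in> F \<Longrightarrow> g \<in> borel_measurable m \<Longrightarrow> AE x in m. f x = g x \<Longrightarrow> g \<in> F"
  using AE_closed by blast

lemma E_AE_cong_left:
  "f \<in> F \<Longrightarrow> g \<in> borel_measurable m \<Longrightarrow> AE x in m. f x = g x \<Longrightarrow> h \<in> F \<Longrightarrow> E g h = E f h"
  using AE_closed by blast

lemma psd_E: "psd_form F E"
proof
  fix f g h :: "'a \<Rightarrow> real" and c :: real
  note D = dir[unfolded dirichlet_form_def]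
  assume f: "f \<in> F"
  show "(\<lambda>x. c * f x) \<in> F" using D f by blast
  show "0 \<le> E f f" using D f by blast
  { assume "h \<in> F" then show "E (\<lambda>x. c * f x) h = c * E f h" using D f by blast }
  assume g: "g \<in> F"
  show "(\<lambda>x. f x + g x) \<in> F" using D f g by blast
  show "E f g = E g f" using D f g by blast
  assume "h \<in> F"
  then show "E (\<lambda>x. f x + g x) h = E f h + E g h" using D f g by blast
qed

sublocale E: psd_form F E by (rule psd_E)

lemma E_AE_cong_right:
  "f \<in> F \<Longrightarrow> g \<in> borel_measurable m \<Longrightarrow> AE x in m. f x = g x \<Longrightarrow> h \<in> F \<Longrightarrow> E h g = E h f"
  by (metis E.sym E_AE_cong_left F_AE_cong)

lemma F_zero: "f \<in> F \<Longrightarrow> (\<lambda>x. 0) \<in> F"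
  using E.scale_closed[of f 0] by simp

lemma F_mult: "f \<in> F \<Longrightarrow> (\<lambda>x. c * f x) \<in> F"
  by (rule E.scale_closed)

text \<open>The squared norm of the Hilbert space \<open>F\<close>.\<close>

definition q1 :: "('a \<Rightarrow> real) \<Rightarrow> real" where
  "q1 f = E f f + nsq m f"

lemma E1_norm_q1: "E1_norm m E f = sqrt (q1 f)"
  by (simp add: E1_norm_def q1_def norm2_power2)

lemma E1_norm_less: "0 < e \<Longrightarrow> E1_norm m E f < e \<longleftrightarrow> q1 f < e\<^sup>2"
  unfolding E1_norm_q1 by (metis real_sqrt_less_iff real_sqrt_abs abs_of_pos)

lemma E1_norm_all_less: "(\<forall>e>0. \<exists>g\<in>S. E1_norm m E (h g) < e) \<longleftrightarrow> (\<forall>e>0. \<exists>g\<in>S. q1 (h g) < e)"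
proof safe
  fix e :: real assume "e > 0" "\<forall>e>0. \<exists>g\<in>S. E1_norm m E (h g) < e"
  then obtain g where "g \<in> S" "E1_norm m E (h g) < sqrt e"
    by (meson real_sqrt_gt_zero)
  then show "\<exists>g\<in>S. q1 (h g) < e" unfolding E1_norm_q1 using real_sqrt_less_iff by blast
next
  fix e :: real assume "e > 0" "\<forall>e>0. \<exists>g\<in>S. q1 (h g) < e"
  then show "\<exists>g\<in>S. E1_norm m E (h g) < e" using E1_norm_less[of e] zero_less_power[of e 2] by metis
qed

lemma q1_nonneg: "f \<in> F \<Longrightarrow> 0 \<le> q1 f"
  by (simp add: q1_def E.nonneg)

lemma E_le_q1: "E f f \<le> q1 f"
  by (simp add: q1_def)

lemma nsq_le_q1: "f \<in> F \<Longrightarrow> nsq m f \<le> q1 f"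
  by (simp add: q1_def E.nonneg)

lemma q1_swap:
  assumes "f \<in> F" "g \<in> F" shows "q1 (\<lambda>x. f x - g x) = q1 (\<lambda>x. g x - f x)"
  using assms by (simp add: q1_def E.diff_self E.sym[of g f] nsq_def power2_commute)

lemma F_complete:
  assumes "\<And>n. w n \<in> F"
    and "\<And>e. e > 0 \<Longrightarrow> \<exists>N. \<forall>i\<ge>N. \<forall>j\<ge>N. q1 (\<lambda>x. w i x - w j x) < e"
  shows "\<exists>f\<in>F. (\<lambda>n. q1 (\<lambda>x. w n x - f x)) \<longlonglongrightarrow> 0"
proof -
  have "\<forall>e>0. \<exists>N. \<forall>i\<ge>N. \<forall>j\<ge>N. E1_norm m E (\<lambda>x. w i x - w j x) < e"
    using assms(2) E1_norm_less by (meson zero_less_power)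
  moreover have closed: "(\<forall>n. w n \<in> F) \<longrightarrow>
        (\<forall>e>0. \<exists>N. \<forall>i\<ge>N. \<forall>j\<ge>N. E1_norm m E (\<lambda>x. w i x - w j x) < e) \<longrightarrow>
        (\<exists>f\<in>F. (\<lambda>n. E1_norm m E (\<lambda>x. w n x - f x)) \<longlonglongrightarrow> 0)" for w
    using dir unfolding dirichlet_form_def by (elim conjE allE)
  ultimately obtain f where f: "f \<in> F" "(\<lambda>n. E1_norm m E (\<lambda>x. w n x - f x)) \<longlonglongrightarrow> 0"
    using closed[of w] assms(1) by blast
  from tendsto_power[OF f(2), of 2] have "(\<lambda>n. q1 (\<lambda>x. w n x - f x)) \<longlonglongrightarrow> 0"
    using f(1) assms(1) by (simp add: E1_norm_q1 q1_nonneg E.diff_closed)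
  then show ?thesis using f by blast
qed

text \<open>This lemma stands in for weak compactness. If elements of bounded energy of a convex set
  \<open>S\<close> come arbitrarily close to \<open>u\<close> in \<open>L2\<close>, then
  \<open>u\<close> lies in \<open>F\<close>, and in the norm closure of \<open>S\<close>. Among
  the elements of \<open>S\<close> at squared distance less than \<open>1 / (n + 1)\<close> from
  \<open>u\<close>, near minimisers of the energy form a Cauchy sequence by the parallelogram law.\<close>

lemma weak_closure:
  assumes S: "S \<subseteq> F" and mid: "\<And>f g. f \<in> S \<Longrightarrow> g \<in> S \<Longrightarrow> (\<lambda>x. (f x + g x) / 2) \<in> S"
    and u: "u \<in> L2 m"
    and ap: "\<And>d. d > 0 \<Longrightarrow> \<exists>w\<in>S. nsq m (\<lambda>x. w x - u x) < d \<and> E w w \<le> K"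
  shows "u \<in> F" and "\<And>e. e > 0 \<Longrightarrow> \<exists>w\<in>S. q1 (\<lambda>x. u x - w x) < e"
proof -
  define C where "C n = {w \<in> S. nsq m (\<lambda>x. w x - u x) < 1 / real (Suc n)}" for n
  define I where "I n = (INF w\<in>C n. E w w)" for n
  have CS: "w \<in> S" "w \<in> F" if "w \<in> C n" for w n using that S by (auto simp: C_def)
  have ne: "\<exists>w\<in>C n. E w w \<le> K" for n
    using ap[of "1 / real (Suc n)"] by (auto simp: C_def)
  have bdd: "bdd_below ((\<lambda>w. E w w) ` C n)" for n
    by (rule bdd_belowI[where m=0]) (auto simp: E.nonneg CS)
  have I_le: "I n \<le> E w w" if "w \<in> C n" for n w
    unfolding I_def using bdd that by (rule cINF_lower)
  have IK: "I n \<le> K" for n using ne[of n] I_le by force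
  have Cdec: "C j \<subseteq> C i" if "i \<le> j" for i j
  proof -
    have "1 / real (Suc j) \<le> 1 / real (Suc i)" using that by (simp add: field_simps)
    then show ?thesis unfolding C_def by fastforce
  qed
  have Iinc: "I i \<le> I j" if "i \<le> j" for i j
    unfolding I_def using ne[of j] by (intro cINF_superset_mono[OF _ bdd Cdec[OF that]]) auto
  have "convergent I"
    using incseq_convergent[of I K] Iinc IK by (metis convergentI incseq_def)
  then obtain J where J: "I \<longlonglongrightarrow> J" by (auto simp: convergent_def)
  have IJ: "I n \<le> J" for n using Iinc J by (intro incseq_le) (auto simp: incseq_def)
  have "\<exists>w\<in>C n. E w w < I n + 1 / real (Suc n)" for n
    using cInf_lessD[of "(\<lambda>w. E w w) ` C n" "I n + 1 / real (Suc n)"] ne[of n]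
    by (fastforce simp: I_def)
  then obtain w where w: "\<And>n. w n \<in> C n" "\<And>n. E (w n) (w n) < I n + 1 / real (Suc n)"
    by metis
  have wF: "w n \<in> F" for n using w(1) CS by blast
  have wu: "nsq m (\<lambda>x. w n x - u x) < 1 / real (Suc n)" for n using w(1) by (auto simp: C_def)
  have midC: "(\<lambda>x. (f x + g x) / 2) \<in> C n" if "f \<in> C n" "g \<in> C n" for f g n
  proof -
    have *: "(\<lambda>x. f x - u x) \<in> L2 m" "(\<lambda>x. g x - u x) \<in> L2 m"
      using L2_diff[OF F_L2[OF CS(2)[OF that(1)]] u] L2_diff[OF F_L2[OF CS(2)[OF that(2)]] u] by auto
    have "(\<lambda>x. ((f x - u x) + (g x - u x)) / 2) = (\<lambda>x. (f x + g x) / 2 - u x)"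
      by (auto simp: field_simps)
    then show ?thesis using nsq_mid_le[OF *] that mid by (auto simp: C_def)
  qed
  have cau: "q1 (\<lambda>x. w i x - w j x) \<le> 4 * (J - I N) + 8 / real (Suc N)"
    if "N \<le> i" "N \<le> j" for i j N
  proof -
    \<comment> \<open>The midpoint competes in \<open>C N\<close>, so its energy is at least \<open>I N\<close>.\<close>
    have mC: "(\<lambda>x. (w i x + w j x) / 2) \<in> C N"
      using that Cdec w(1) by (intro midC) auto
    have ii: "1 / real (Suc i) \<le> 1 / real (Suc N)" "1 / real (Suc j) \<le> 1 / real (Suc N)"
      using that by (auto simp: field_simps)
    have "E (\<lambda>x. w i x - w j x) (\<lambda>x. w i x - w j x) \<le> 4 * (J - I N) + 4 / real (Suc N)"
      unfolding E.parallelogram[OF wF wF]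
      using I_le[OF mC] w(2)[of i] w(2)[of j] IJ[of i] IJ[of j] ii by simp
    moreover
    have "(\<lambda>x. w i x - w j x) = (\<lambda>x. (w i x - u x) - (w j x - u x))" by auto
    then have "nsq m (\<lambda>x. w i x - w j x) \<le> 4 / real (Suc N)"
      using nsq_diff_le[OF L2_diff[OF F_L2[OF wF[of i]] u] L2_diff[OF F_L2[OF wF[of j]] u]]
        wu[of i] wu[of j] ii by simp
    ultimately show ?thesis by (simp add: q1_def)
  qed
  have lim: "(\<lambda>N. 4 * (J - I N) + 8 / real (Suc N)) \<longlonglongrightarrow> 4 * (J - J) + 0"
    by (intro tendsto_intros J LIMSEQ_Suc[OF lim_const_over_n])
  have "\<exists>N. \<forall>i\<ge>N. \<forall>j\<ge>N. q1 (\<lambda>x. w i x - w j x) < e" if "e > 0" for e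
  proof -
    have "\<forall>\<^sub>F N in sequentially. 4 * (J - I N) + 8 / real (Suc N) < e"
      using order_tendstoD(2)[OF lim, of e] that by simp
    then obtain N where "4 * (J - I N) + 8 / real (Suc N) < e"
      by (auto simp: eventually_sequentially)
    then show ?thesis using cau[of N] by force
  qed
  from F_complete[of w, OF wF this] obtain f where
    f: "f \<in> F" "(\<lambda>n. q1 (\<lambda>x. w n x - f x)) \<longlonglongrightarrow> 0" by blast
  have "nsq m (\<lambda>x. u x - f x) \<le> 2 * q1 (\<lambda>x. w n x - f x) + 2 * (1 / real (Suc n))" for n
  proof -
    have "(\<lambda>x. u x - f x) = (\<lambda>x. (w n x - f x) - (w n x - u x))" by auto
    then show ?thesis
      using nsq_diff_le[OF L2_diff[OF F_L2[OF wF[of n]] F_L2[OF f(1)]] L2_diff[OF F_L2[OF wF[of n]] u]]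
        wu[of n] nsq_le_q1[OF E.diff_closed[OF wF[of n] f(1)]] by simp
  qed
  moreover have "(\<lambda>n. 2 * q1 (\<lambda>x. w n x - f x) + 2 * (1 / real (Suc n))) \<longlonglongrightarrow> 2 * 0 + 2 * 0"
    by (intro tendsto_intros f(2) LIMSEQ_Suc[OF lim_const_over_n])
  ultimately have "nsq m (\<lambda>x. u x - f x) \<le> 0"
    using LIMSEQ_le_const by (metis (no_types, lifting) add.right_neutral mult_zero_right)
  then have "nsq m (\<lambda>x. u x - f x) = 0" using nsq_nonneg by (metis order_antisym)
  from nsq_eq_0[OF L2_diff[OF u F_L2[OF f(1)]] this] have ae: "AE x in m. f x = u x" by auto
  have um: "u \<in> borel_measurable m" using u by (simp add: L2_def)
  show uF: "u \<in> F" using F_AE_cong[OF f(1) um ae] .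
  fix e :: real assume "e > 0"
  then have "\<forall>\<^sub>F n in sequentially. q1 (\<lambda>x. w n x - f x) < e"
    using order_tendstoD(2)[OF f(2)] by simp
  then obtain n where n: "q1 (\<lambda>x. w n x - f x) < e" by (auto simp: eventually_sequentially)
  have fw: "(\<lambda>x. f x - w n x) \<in> F" and uw: "(\<lambda>x. u x - w n x) \<in> F"
    using f(1) uF wF by (auto intro: E.diff_closed)
  have ae': "AE x in m. f x - w n x = u x - w n x" using ae by auto
  have "q1 (\<lambda>x. u x - w n x) = q1 (\<lambda>x. f x - w n x)"
    unfolding q1_def
    using E_AE_cong_left[OF fw F_meas[OF uw] ae' uw] E_AE_cong_right[OF fw F_meas[OF uw] ae' fw]
      nsq_cong_AE[OF F_meas[OF fw] F_meas[OF uw] ae'] by simp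
  then show "\<exists>w\<in>S. q1 (\<lambda>x. u x - w x) < e"
    using n q1_swap[OF f(1) wF[of n]] CS(1)[OF w(1)[of n]] by (intro bexI[of _ "w n"]) auto
qed

lemma E_self_le_limit:
  assumes "u \<in> F" "0 \<le> K" and ap: "\<And>e. e > 0 \<Longrightarrow> \<exists>w\<in>F. q1 (\<lambda>x. u x - w x) < e \<and> E w w \<le> K"
  shows "E u u \<le> K"
proof -
  have "sqrt (E u u) \<le> sqrt K + e" if "e > 0" for e
  proof -
    obtain w where w: "w \<in> F" "q1 (\<lambda>x. u x - w x) < e\<^sup>2" "E w w \<le> K"
      using ap[of "e\<^sup>2"] \<open>e > 0\<close> by (metis zero_less_power)
    have "sqrt (E u u) \<le> sqrt (E w w) + sqrt (E (\<lambda>x. u x - w x) (\<lambda>x. u x - w x))"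
      using E.triangle_sqrt[OF w(1) E.diff_closed[OF assms(1) w(1)]] by simp
    moreover have "sqrt (E w w) \<le> sqrt K" using w by simp
    moreover have "sqrt (E (\<lambda>x. u x - w x) (\<lambda>x. u x - w x)) \<le> sqrt (e\<^sup>2)"
      using w(2) E_le_q1[of "\<lambda>x. u x - w x"] by (intro real_sqrt_le_mono) linarith
    moreover have "sqrt (e\<^sup>2) = e" using that by simp
    ultimately show ?thesis by linarith
  qed
  then have "sqrt (E u u) \<le> sqrt K" by (rule field_le_epsilon)
  then show ?thesis by simp
qed

lemma E_lower_semicontinuous:
  assumes u: "u \<in> L2 m" and "0 \<le> K"
    and ap: "\<And>d. d > 0 \<Longrightarrow> \<exists>w\<in>F. nsq m (\<lambda>x. w x - u x) < d \<and> E w w \<le> K"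
  shows "u \<in> F" and "E u u \<le> K"
proof -
  let ?S = "{w \<in> F. E w w \<le> K}"
  have mid: "(\<lambda>x. (f x + g x) / 2) \<in> ?S" if "f \<in> ?S" "g \<in> ?S" for f g
    using that E.mid_le[of f g] by (auto intro: E.mid_closed)
  have ap': "\<exists>w\<in>?S. nsq m (\<lambda>x. w x - u x) < d \<and> E w w \<le> K" if "d > 0" for d
    using ap[OF that] by blast
  show uF: "u \<in> F" by (rule weak_closure(1)[OF _ mid u ap']) auto
  have "\<exists>w\<in>?S. q1 (\<lambda>x. u x - w x) < e" if "e > 0" for e
    by (rule weak_closure(2)[OF _ mid u ap' that]) auto
  then show "E u u \<le> K" by (intro E_self_le_limit[OF uF \<open>0 \<le> K\<close>]) auto
qed

text \<open>The functional \<open>E f\<close> is continuous along \<open>L2\<close>-convergent families of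
  bounded energy. Only its vanishing is needed: \<open>weak_closure\<close> is applied to the
  kernel of \<open>E f\<close>.\<close>

lemma E_zero_limit:
  assumes f: "f \<in> F" and u: "u \<in> F"
    and ap: "\<And>d. d > 0 \<Longrightarrow> \<exists>w\<in>F. nsq m (\<lambda>x. w x - u x) < d \<and> E w w \<le> K \<and> E f w = 0"
  shows "E f u = 0"
proof -
  let ?S = "{w \<in> F. E f w = 0}"
  have mid: "(\<lambda>x. (g x + h x) / 2) \<in> ?S" if "g \<in> ?S" "h \<in> ?S" for g h
    using that f by (auto intro: E.mid_closed simp: E.mid_right)
  have ap': "\<exists>w\<in>?S. nsq m (\<lambda>x. w x - u x) < d \<and> E w w \<le> K" if "d > 0" for d
    using ap[OF that] by blast
  have *: "\<exists>w\<in>?S. q1 (\<lambda>x. u x - w x) < e" if "e > 0" for e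
    by (rule weak_closure(2)[OF _ mid F_L2[OF u] ap' that]) auto
  have "(E f u)\<^sup>2 \<le> 0 + e" if "e > 0" for e
  proof -
    have "e / (E f f + 1) > 0" using that E.nonneg[OF f] by simp
    then obtain w where w: "w \<in> F" "E f w = 0" "q1 (\<lambda>x. u x - w x) < e / (E f f + 1)"
      using *[of "e / (E f f + 1)"] by auto
    have d: "(\<lambda>x. u x - w x) \<in> F" using u w by (intro E.diff_closed)
    have "(E f u)\<^sup>2 = (E f (\<lambda>x. u x - w x))\<^sup>2" using w u f by (simp add: E.diff_right)
    also have "\<dots> \<le> E f f * E (\<lambda>x. u x - w x) (\<lambda>x. u x - w x)"
      by (rule E.cauchy_schwarz[OF f d])
    also have "\<dots> \<le> (E f f + 1) * (e / (E f f + 1))"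
      using w(3) E_le_q1[of "\<lambda>x. u x - w x"] E.nonneg[OF f] E.nonneg[OF d]
      by (intro mult_mono) auto
    also have "\<dots> = e" using E.nonneg[OF f] by simp
    finally show ?thesis by simp
  qed
  then have "(E f u)\<^sup>2 \<le> 0" by (rule field_le_epsilon)
  then show ?thesis by simp
qed

end

section \<open>Contractions, lattice operations and the Riesz representation\<close>

context dirichlet
begin

lemma unit_contraction: "\<forall>f\<in>F. (\<lambda>x. min (max (f x) 0) 1) \<in> F \<and>
    E (\<lambda>x. min (max (f x) 0) 1) (\<lambda>x. min (max (f x) 0) 1) \<le> E f f"
  using dir unfolding dirichlet_form_def by (elim conjE)

lemma truncation:
  assumes f: "f \<in> F" and c: "0 < c"
  shows "(\<lambda>x. min (max (f x) 0) c) \<in> F"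
    and "E (\<lambda>x. min (max (f x) 0) c) (\<lambda>x. min (max (f x) 0) c) \<le> E f f"
proof -
  let ?g = "\<lambda>x. (1 / c) * f x"
  have g: "?g \<in> F" using f by (rule E.scale_closed)
  let ?h = "\<lambda>x. min (max (?g x) 0) 1"
  have h: "?h \<in> F" "E ?h ?h \<le> E ?g ?g" using bspec[OF unit_contraction g] by blast+
  have eq: "(\<lambda>x. min (max (f x) 0) c) = (\<lambda>x. c * ?h x)"
    using c by (auto simp: fun_eq_iff min_def max_def field_simps)
  show "(\<lambda>x. min (max (f x) 0) c) \<in> F" unfolding eq using h(1) by (rule E.scale_closed)
  have "E (\<lambda>x. c * ?h x) (\<lambda>x. c * ?h x) = c\<^sup>2 * E ?h ?h" using E.scale_self[OF h(1)] .
  also have "\<dots> \<le> c\<^sup>2 * E ?g ?g" using h(2) by (intro mult_left_mono) auto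
  also have "\<dots> = E f f" using c f by (subst E.scale_self) (auto simp: power2_eq_square)
  finally show "E (\<lambda>x. min (max (f x) 0) c) (\<lambda>x. min (max (f x) 0) c) \<le> E f f"
    unfolding eq .
qed

lemma nsq_truncation_tendsto:
  assumes f: "f \<in> L2 m"
  shows "(\<lambda>n. nsq m (\<lambda>x. min (max (f x) 0) (real (Suc n)) - max (f x) 0)) \<longlonglongrightarrow> 0"
proof -
  have [measurable]: "f \<in> borel_measurable m" using f by (simp add: L2_def)
  have "(\<lambda>n. \<integral>x. (min (max (f x) 0) (real (Suc n)) - max (f x) 0)\<^sup>2 \<partial>m)
      \<longlonglongrightarrow> (\<integral>x. 0 \<partial>m)"
  proof (rule integral_dominated_convergence[where w="\<lambda>x. (f x)\<^sup>2"])
    show "integrable m (\<lambda>x. (f x)\<^sup>2)" using f by (simp add: L2_def)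
    show "AE x in m. (\<lambda>n. (min (max (f x) 0) (real (Suc n)) - max (f x) 0)\<^sup>2) \<longlonglongrightarrow> 0"
    proof (rule AE_I2)
      fix x
      obtain N where N: "max (f x) 0 \<le> real N" using real_arch_simple by blast
      have "\<forall>\<^sub>F n in sequentially. (min (max (f x) 0) (real (Suc n)) - max (f x) 0)\<^sup>2 = 0"
        unfolding eventually_sequentially
        by (rule exI[of _ N]) (use N in \<open>auto simp: min_def\<close>)
      then show "(\<lambda>n. (min (max (f x) 0) (real (Suc n)) - max (f x) 0)\<^sup>2) \<longlonglongrightarrow> 0"
        by (rule tendsto_eventually)
    qed
    show "AE x in m. norm ((min (max (f x) 0) (real (Suc n)) - max (f x) 0)\<^sup>2) \<le> (f x)\<^sup>2" for n
      by (rule AE_I2) (auto simp: abs_le_square_iff[symmetric] min_def max_def)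
  qed auto
  then show ?thesis by (simp add: nsq_def)
qed

text \<open>The truncations at height \<open>n + 1\<close> have at most the energy of \<open>f\<close>, and
  they converge to the positive part in \<open>L2\<close>.\<close>

lemma pos_part:
  assumes f: "f \<in> F"
  shows "(\<lambda>x. max (f x) 0) \<in> F"
    and "E (\<lambda>x. max (f x) 0) (\<lambda>x. max (f x) 0) \<le> E f f"
proof -
  have L: "(\<lambda>x. max (f x) 0) \<in> L2 m"
    using f by (intro L2_bound[OF F_L2[OF f]]) auto
  have ap: "\<exists>w\<in>F. nsq m (\<lambda>x. w x - max (f x) 0) < d \<and> E w w \<le> E f f" if "d > 0" for d
  proof -
    have "\<forall>\<^sub>F n in sequentially. nsq m (\<lambda>x. min (max (f x) 0) (real (Suc n)) - max (f x) 0) < d"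
      using order_tendstoD(2)[OF nsq_truncation_tendsto[OF F_L2[OF f]] that] .
    then obtain n where "nsq m (\<lambda>x. min (max (f x) 0) (real (Suc n)) - max (f x) 0) < d"
      by (auto simp: eventually_sequentially)
    then show ?thesis using truncation[OF f, of "real (Suc n)"]
      by (intro bexI[of _ "\<lambda>x. min (max (f x) 0) (real (Suc n))"]) auto
  qed
  show "(\<lambda>x. max (f x) 0) \<in> F"
    and "E (\<lambda>x. max (f x) 0) (\<lambda>x. max (f x) 0) \<le> E f f"
    using E_lower_semicontinuous[OF L E.nonneg[OF f] ap] by blast+
qed

lemma small_multiple_le_imp_nonpos:
  fixes a b :: real
  assumes "\<And>t. t > 0 \<Longrightarrow> 2 * a \<le> t * b" shows "a \<le> 0"
proof (rule ccontr)
  assume "\<not> a \<le> 0"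
  then have a: "a > 0" by simp
  have "b > 0" using assms[of 1] a by simp
  then show False using assms[of "a / b"] a by simp
qed

text \<open>The positive and negative parts of a function have nonpositive mutual energy: for \<open>t > 0\<close> the positive
  part of \<open>f\<^sup>+ - t f\<^sup>-\<close> is \<open>f\<^sup>+\<close>, so
  \<open>E f\<^sup>+ f\<^sup>+ \<le> E (f\<^sup>+ - t f\<^sup>-) (f\<^sup>+ - t f\<^sup>-)\<close>;
  then let \<open>t\<close> tend to \<open>0\<close>.\<close>

lemma E_pos_neg_nonpos:
  assumes f: "f \<in> F"
  shows "E (\<lambda>x. max (f x) 0) (\<lambda>x. max (- f x) 0) \<le> 0"
proof -
  let ?p = "\<lambda>x. max (f x) 0" and ?n = "\<lambda>x. max (- f x) 0"
  have p: "?p \<in> F" by (rule pos_part(1)[OF f])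
  have n: "?n \<in> F" using pos_part(1)[OF F_mult[OF f, of "-1"]] by simp
  have "2 * E ?p ?n \<le> t * E ?n ?n" if t: "t > 0" for t
  proof -
    have tn: "(\<lambda>x. t * ?n x) \<in> F" by (rule F_mult[OF n])
    have eq: "(\<lambda>x. max (?p x - t * ?n x) 0) = ?p"
      using t by (auto simp: fun_eq_iff max_def not_le mult_le_0_iff mult_neg_pos)
    have "E ?p ?p \<le> E (\<lambda>x. ?p x - t * ?n x) (\<lambda>x. ?p x - t * ?n x)"
      using pos_part(2)[OF E.diff_closed[OF p tn]] unfolding eq .
    also have "\<dots> = E ?p ?p - 2 * (t * E ?p ?n) + t\<^sup>2 * E ?n ?n"
      by (simp only: E.diff_self[OF p tn] E.scale_self[OF n] E.scale_right[OF n p])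
    finally have "2 * E ?p ?n * t \<le> (t * E ?n ?n) * t"
      by (simp add: power2_eq_square algebra_simps)
    then show ?thesis using t mult_le_cancel_right_pos by blast
  qed
  then show ?thesis by (rule small_multiple_le_imp_nonpos)
qed

lemma E_pos_part_ge:
  assumes f: "f \<in> F"
  shows "E (\<lambda>x. max (f x) 0) (\<lambda>x. max (f x) 0) \<le> E f (\<lambda>x. max (f x) 0)"
proof -
  let ?p = "\<lambda>x. max (f x) 0" and ?n = "\<lambda>x. max (- f x) 0"
  have p: "?p \<in> F" by (rule pos_part(1)[OF f])
  have n: "?n \<in> F" using pos_part(1)[OF F_mult[OF f, of "-1"]] by simp
  have "f = (\<lambda>x. ?p x - ?n x)" by (auto simp: max_def)
  then have "E f ?p = E ?p ?p - E ?n ?p" by (metis (no_types, lifting) E.diff_left[OF p n p])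
  then show ?thesis using E_pos_neg_nonpos[OF f] E.sym[OF p n] by simp
qed

text \<open>With \<open>u\<close> the unit contraction of \<open>f\<close> and
  \<open>r = (f - 1)\<^sup>+\<close>, the unit contraction of \<open>u + t r\<close> is
  \<open>u\<close> for every \<open>t > 0\<close>, so that the energy does not decrease along this
  ray.\<close>

lemma E_truncation_rest_nonneg:
  assumes f: "f \<in> F"
  shows "0 \<le> E (\<lambda>x. min (max (f x) 0) 1) (\<lambda>x. max (f x - 1) 0)"
    and "(\<lambda>x. max (f x - 1) 0) \<in> F"
proof -
  let ?u = "\<lambda>x. min (max (f x) 0) 1" and ?r = "\<lambda>x. max (f x - 1) 0"
  have u: "?u \<in> F" using unit_contraction f by blast
  have "?r = (\<lambda>x. max (f x) 0 - ?u x)" by (auto simp: fun_eq_iff)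
  then show r: "?r \<in> F" using E.diff_closed[OF pos_part(1)[OF f] u] by simp
  have "2 * (- E ?u ?r) \<le> t * E ?r ?r" if t: "t > 0" for t
  proof -
    have tr: "(\<lambda>x. t * ?r x) \<in> F" by (rule F_mult[OF r])
    have eq: "(\<lambda>x. min (max (?u x + t * ?r x) 0) 1) = ?u"
    proof
      fix x
      show "min (max (?u x + t * ?r x) 0) 1 = ?u x"
      proof (cases "f x \<le> 1")
        case False
        then have "0 \<le> t * (f x - 1)" using t by simp
        then show ?thesis using False by auto
      qed auto
    qed
    have "E ?u ?u \<le> E (\<lambda>x. ?u x + t * ?r x) (\<lambda>x. ?u x + t * ?r x)"
      using bspec[OF unit_contraction E.add_closed[OF u tr]] unfolding eq by blast
    also have "\<dots> = E ?u ?u + 2 * (t * E ?u ?r) + t\<^sup>2 * E ?r ?r"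
      by (simp only: E.add_self[OF u tr] E.scale_self[OF r] E.scale_right[OF r u])
    finally have "2 * (- E ?u ?r) * t \<le> (t * E ?r ?r) * t"
      by (simp add: power2_eq_square algebra_simps)
    then show ?thesis using t mult_le_cancel_right_pos by blast
  qed
  then have "- E ?u ?r \<le> 0" by (rule small_multiple_le_imp_nonpos)
  then show "0 \<le> E ?u ?r" by simp
qed

lemma F_min:
  assumes f: "f \<in> F" and g: "g \<in> F"
  shows "(\<lambda>x. min (f x) (g x)) \<in> F"
    and "E (\<lambda>x. min (f x) (g x)) (\<lambda>x. min (f x) (g x)) \<le> 6 * E f f + 4 * E g g"
proof -
  have d: "(\<lambda>x. f x - g x) \<in> F" using f g by (rule E.diff_closed)
  note p = pos_part[OF d]
  have eq: "(\<lambda>x. min (f x) (g x)) = (\<lambda>x. f x - max (f x - g x) 0)"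
    by (auto simp: min_def max_def)
  show "(\<lambda>x. min (f x) (g x)) \<in> F" unfolding eq using f p(1) by (rule E.diff_closed)
  show "E (\<lambda>x. min (f x) (g x)) (\<lambda>x. min (f x) (g x)) \<le> 6 * E f f + 4 * E g g"
    unfolding eq using E.diff_self_le[OF f p(1)] p(2) E.diff_self_le[OF f g] by simp
qed

lemma q1_add_le: "f \<in> F \<Longrightarrow> g \<in> F \<Longrightarrow> q1 (\<lambda>x. f x + g x) \<le> 2 * q1 f + 2 * q1 g"
  using E.add_self_le[of f g] nsq_add_le[OF F_L2 F_L2, of f g] by (simp add: q1_def)

lemma q1_scale: "f \<in> F \<Longrightarrow> q1 (\<lambda>x. c * f x) = c\<^sup>2 * q1 f"
  by (simp add: q1_def E.scale_self nsq_def power_mult_distrib algebra_simps)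

lemma E_near:
  assumes "f \<in> F" "g \<in> F" "q1 (\<lambda>x. f x - g x) \<le> 1"
  shows "E g g \<le> 2 * E f f + 2"
proof -
  have "g = (\<lambda>x. f x - (f x - g x))" by auto
  then have "E g g \<le> 2 * E f f + 2 * E (\<lambda>x. f x - g x) (\<lambda>x. f x - g x)"
    using E.diff_self_le[OF assms(1) E.diff_closed[OF assms(1,2)]] by simp
  then show ?thesis using assms(3) E_le_q1[of "\<lambda>x. f x - g x"] by simp
qed

text \<open>The Riesz representation theorem on a closed subspace on which a Poincare inequality holds, so
  that the energy alone is a complete norm there.\<close>

lemma riesz:
  assumes S: "S \<subseteq> F" "S \<noteq> {}" and S_add: "\<And>f g. f \<in> S \<Longrightarrow> g \<in> S \<Longrightarrow> (\<lambda>x. f x + g x) \<in> S"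
    and S_scale: "\<And>f c. f \<in> S \<Longrightarrow> (\<lambda>x. c * f x) \<in> S"
    and S_closed: "\<And>f. f \<in> F \<Longrightarrow> (\<And>e. e > 0 \<Longrightarrow> \<exists>g\<in>S. q1 (\<lambda>x. f x - g x) < e) \<Longrightarrow> f \<in> S"
    and poincare: "\<And>f. f \<in> S \<Longrightarrow> nsq m f \<le> K * E f f"
    and l_add: "\<And>f g. f \<in> S \<Longrightarrow> g \<in> S \<Longrightarrow> l (\<lambda>x. f x + g x) = l f + l g"
    and l_scale: "\<And>f c. f \<in> S \<Longrightarrow> l (\<lambda>x. c * f x) = c * l f"
    and l_bdd: "\<And>f. f \<in> S \<Longrightarrow> (l f)\<^sup>2 \<le> L * E f f"
  shows "\<exists>u\<in>S. \<forall>f\<in>S. E u f = l f"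
proof -
  define J where "J f = E f f - 2 * l f" for f
  have SF: "f \<in> F" if "f \<in> S" for f using S that by blast
  have S_mid: "(\<lambda>x. (f x + g x) / 2) \<in> S" if "f \<in> S" "g \<in> S" for f g
    using S_scale[OF S_add[OF that], of "1/2"] by simp
  have l_mid: "l (\<lambda>x. (f x + g x) / 2) = (l f + l g) / 2" if "f \<in> S" "g \<in> S" for f g
    using l_scale[OF S_add[OF that], of "1/2"] l_add[OF that] by simp
  have S_diff: "(\<lambda>x. f x - g x) \<in> S" if "f \<in> S" "g \<in> S" for f g
    using S_add[OF that(1) S_scale[OF that(2), of "-1"]] by simp
  define L' where "L' = max L 0"
  have l_bdd': "(l f)\<^sup>2 \<le> L' * E f f" if "f \<in> S" for f
    using l_bdd[OF that] mult_right_mono[of L L' "E f f"] E.nonneg[OF SF[OF that]] by (simp add: L'_def)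
  have Jlow: "- L' \<le> J f" if f: "f \<in> S" for f
  proof -
    have e: "0 \<le> E f f" using SF f E.nonneg by blast
    have "(2 * l f)\<^sup>2 \<le> 4 * (L' * E f f)" using l_bdd'[OF f] by (simp add: power2_eq_square)
    also have "\<dots> \<le> (L' + E f f)\<^sup>2"
      using zero_le_power2[of "L' - E f f"] by (simp add: power2_eq_square algebra_simps)
    finally have sq: "(2 * l f)\<^sup>2 \<le> (L' + E f f)\<^sup>2" .
    have "2 * l f \<le> L' + E f f"
      by (rule power2_le_imp_le[OF sq]) (use e in \<open>simp add: L'_def\<close>)
    then show ?thesis by (simp add: J_def)
  qed
  then have bdd: "bdd_below (J ` S)" by (intro bdd_belowI[of _ "- L'"]) auto
  define j where "j = (INF f\<in>S. J f)"
  have jle: "j \<le> J f" if "f \<in> S" for f unfolding j_def using bdd that by (rule cINF_lower)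
  have "\<exists>w\<in>S. J w < j + 1 / real (Suc n)" for n
    using cInf_lessD[of "J ` S" "j + 1 / real (Suc n)"] S(2) by (auto simp: j_def)
  then obtain w where w: "\<And>n. w n \<in> S" "\<And>n. J (w n) < j + 1 / real (Suc n)" by metis
  have wF: "w n \<in> F" for n using w(1) SF by blast
  define K' where "K' = max K 0"
  have cau: "q1 (\<lambda>x. w i x - w k x) \<le> (1 + K') * (4 / real (Suc N))" if "N \<le> i" "N \<le> k" for i k N
  proof -
    have ii: "1 / real (Suc i) \<le> 1 / real (Suc N)" "1 / real (Suc k) \<le> 1 / real (Suc N)"
      using that by (auto simp: field_simps)
    have e: "E (\<lambda>x. w i x - w k x) (\<lambda>x. w i x - w k x) \<le> 4 / real (Suc N)"
      unfolding E.parallelogram[OF wF wF]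
      using jle[OF S_mid[OF w(1)[of i] w(1)[of k]]] w(2)[of i] w(2)[of k] ii
      unfolding J_def l_mid[OF w(1) w(1)] by argo
    have "nsq m (\<lambda>x. w i x - w k x) \<le> K * E (\<lambda>x. w i x - w k x) (\<lambda>x. w i x - w k x)"
      by (rule poincare[OF S_diff[OF w(1) w(1)]])
    also have "\<dots> \<le> K' * (4 / real (Suc N))"
      using e E.nonneg[OF E.diff_closed[OF wF wF]] by (intro mult_mono) (auto simp: K'_def)
    finally show ?thesis using e unfolding q1_def by argo
  qed
  have lim: "(\<lambda>N. (1 + K') * (4 / real (Suc N))) \<longlonglongrightarrow> (1 + K') * 0"
    by (intro tendsto_intros LIMSEQ_Suc[OF lim_const_over_n])
  have "\<exists>N. \<forall>i\<ge>N. \<forall>k\<ge>N. q1 (\<lambda>x. w i x - w k x) < e" if "e > 0" for e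
  proof -
    have "\<forall>\<^sub>F N in sequentially. (1 + K') * (4 / real (Suc N)) < e"
      using order_tendstoD(2)[OF lim, of e] that by simp
    then obtain N where "(1 + K') * (4 / real (Suc N)) < e"
      by (auto simp: eventually_sequentially)
    then show ?thesis using cau[of N] by force
  qed
  from F_complete[of w, OF wF this] obtain u where
    u: "u \<in> F" "(\<lambda>n. q1 (\<lambda>x. w n x - u x)) \<longlonglongrightarrow> 0" by blast
  have uS: "u \<in> S"
  proof (rule S_closed[OF u(1)])
    fix e :: real assume "e > 0"
    then have "\<forall>\<^sub>F n in sequentially. q1 (\<lambda>x. w n x - u x) < e"
      using order_tendstoD(2)[OF u(2)] by simp
    then obtain n where "q1 (\<lambda>x. w n x - u x) < e" by (auto simp: eventually_sequentially)
    then show "\<exists>g\<in>S. q1 (\<lambda>x. u x - g x) < e"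
      using w(1)[of n] q1_swap[OF wF[of n] u(1)] by auto
  qed
  have "E u f = l f" if f: "f \<in> S" for f
  proof -
    have fF: "f \<in> F" using f SF by blast
    have bd: "(E (w n) f - l f)\<^sup>2 \<le> (E f f + 1) * (1 / real (Suc n))" for n
    proof -
      define a where "a = E (w n) f - l f"
      define t where "t = - a / (E f f + 1)"
      \<comment> \<open>The value of \<open>t\<close> minimises \<open>2 t a + t\<^sup>2 (E f f + 1)\<close>; adding \<open>1\<close> avoids a division by zero.\<close>
      have p: "E f f + 1 > 0" using E.nonneg[OF fF] by simp
      have "j \<le> J (\<lambda>x. w n x + t * f x)" by (intro jle S_add S_scale f w)
      also have "\<dots> = J (w n) + 2 * t * a + t\<^sup>2 * E f f"
        using wF[of n] fF w(1)[of n] f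
        by (simp add: J_def a_def E.add_self E.scale_closed E.scale_right E.scale_left l_add l_scale
            S_scale algebra_simps power2_eq_square)
      finally have "0 \<le> 1 / real (Suc n) + 2 * t * a + t\<^sup>2 * E f f" using w(2)[of n] by simp
      also have "\<dots> \<le> 1 / real (Suc n) + 2 * t * a + t\<^sup>2 * (E f f + 1)" by (simp add: algebra_simps)
      also have "\<dots> = 1 / real (Suc n) - a\<^sup>2 / (E f f + 1)"
      proof -
        have "2 * (- a / p) * a + (- a / p)\<^sup>2 * p = - (a\<^sup>2 / p)" if "p > 0" for p :: real
          using that by (simp add: field_simps power2_eq_square)
        from this[OF p] show ?thesis unfolding t_def by simp
      qed
      finally have "a\<^sup>2 / (E f f + 1) \<le> 1 / real (Suc n)" by simp
      then show ?thesis using p unfolding a_def by (simp add: pos_divide_le_eq mult.commute)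
    qed
    have "(\<lambda>n. (E f f + 1) * (1 / real (Suc n))) \<longlonglongrightarrow> (E f f + 1) * 0"
      by (intro tendsto_intros LIMSEQ_Suc[OF lim_const_over_n])
    then have l1: "(\<lambda>n. (E f f + 1) * (1 / real (Suc n))) \<longlonglongrightarrow> 0" by simp
    have "(\<lambda>n. (E (w n) f - l f)\<^sup>2) \<longlonglongrightarrow> 0"
      by (rule tendsto_sandwich[OF _ _ tendsto_const l1]) (simp_all only: bd zero_le_power2 eventually_True)
    then have a1: "(\<lambda>n. E (w n) f - l f) \<longlonglongrightarrow> 0" by simp
    have bd2: "(E (w n) f - E u f)\<^sup>2 \<le> q1 (\<lambda>x. w n x - u x) * E f f" for n
    proof -
      have "(E (w n) f - E u f)\<^sup>2 = (E (\<lambda>x. w n x - u x) f)\<^sup>2"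
        using wF[of n] u(1) fF by (simp add: E.diff_left)
      also have "\<dots> \<le> E (\<lambda>x. w n x - u x) (\<lambda>x. w n x - u x) * E f f"
        by (rule E.cauchy_schwarz[OF E.diff_closed[OF wF u(1)] fF])
      also have "\<dots> \<le> q1 (\<lambda>x. w n x - u x) * E f f"
        by (intro mult_right_mono E_le_q1 E.nonneg[OF fF])
      finally show ?thesis .
    qed
    have "(\<lambda>n. q1 (\<lambda>x. w n x - u x) * E f f) \<longlonglongrightarrow> 0 * E f f"
      by (intro tendsto_intros u)
    then have l2: "(\<lambda>n. q1 (\<lambda>x. w n x - u x) * E f f) \<longlonglongrightarrow> 0" by simp
    have "(\<lambda>n. (E (w n) f - E u f)\<^sup>2) \<longlonglongrightarrow> 0"
      by (rule tendsto_sandwich[OF _ _ tendsto_const l2]) (simp_all only: bd2 zero_le_power2 eventually_True)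
    then have a2: "(\<lambda>n. E (w n) f - E u f) \<longlonglongrightarrow> 0" by simp
    have "(\<lambda>n. E u f - l f) \<longlonglongrightarrow> 0"
      using tendsto_diff[OF a1 a2] by simp
    then show ?thesis using LIMSEQ_const_iff[of "E u f - l f" 0] by simp
  qed
  then show ?thesis using uS by blast
qed

end

section \<open>Locality and the form domain of an open set\<close>

lemma compactly_in_mono: "A \<subseteq> B \<Longrightarrow> B \<Subset> D \<Longrightarrow> D \<subseteq> D' \<Longrightarrow> A \<Subset> (D' :: 'a::t2_space set)"
  unfolding compactly_in_def
  using closure_mono[of A B] compact_Int_closed[OF _ closed_closure, of "closure B" A]
  by (auto simp: Int_absorb1)

lemma compactly_in_Un: "A \<Subset> D \<Longrightarrow> B \<Subset> D \<Longrightarrow> A \<union> B \<Subset> (D :: 'a::t2_space set)"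
  unfolding compactly_in_def by auto

lemma C0_continuous: "f \<in> C0 D \<Longrightarrow> continuous_on UNIV f"
  by (simp add: C0_def)

lemma C0_add: "f \<in> C0 D \<Longrightarrow> g \<in> C0 D \<Longrightarrow> (\<lambda>x. f x + g x :: real) \<in> C0 (D :: 'a::t2_space set)"
  unfolding C0_def
  by (auto intro!: continuous_intros compactly_in_mono[OF _ compactly_in_Un[of "{x. f x \<noteq> 0}" D "{x. g x \<noteq> 0}"] order_refl])

lemma C0_scale: "f \<in> C0 D \<Longrightarrow> (\<lambda>x. c * f x :: real) \<in> C0 (D :: 'a::t2_space set)"
  unfolding C0_def
  by (auto intro!: continuous_intros compactly_in_mono[of _ "{x. f x \<noteq> 0}" D D])

lemma C0_bounded_support: "f \<in> C0 D \<Longrightarrow> continuous_on UNIV g \<Longrightarrow> (\<And>x. f x = 0 \<Longrightarrow> g x = 0)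
    \<Longrightarrow> g \<in> C0 (D :: 'a::t2_space set)"
  unfolding C0_def by (auto intro!: compactly_in_mono[of _ "{x. f x \<noteq> 0}" D D])

lemma C0_mono: "D \<subseteq> D' \<Longrightarrow> C0 D \<subseteq> C0 (D' :: 'a::t2_space set)"
  unfolding C0_def by (auto intro: compactly_in_mono)

lemma eq_0_outside_support: "x \<notin> closure {x. f x \<noteq> (0::real)} \<Longrightarrow> f x = 0"
  using closure_subset[of "{x. f x \<noteq> 0}"] by auto

lemma C0_outside: "f \<in> C0 D \<Longrightarrow> x \<notin> D \<Longrightarrow> f x = 0"
  using eq_0_outside_support[of x f] unfolding C0_def compactly_in_def by auto

text \<open>A metric measure Dirichlet space.\<close>

locale mmd = fixes m :: "'a::polish_space measure" and E :: "'a form" and F :: "('a \<Rightarrow> real) set"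
  assumes mmd: "mmd_space m E F"
begin

sublocale dirichlet m E F
  using mmd by unfold_locales (simp add: mmd_space_def)

lemma regular: "regular_form m E F" and local: "strongly_local m E F" and radon: "radon_measure m"
  and open_pos: "\<And>U. open U \<Longrightarrow> U \<noteq> {} \<Longrightarrow> emeasure m U > 0"
  using mmd by (auto simp: mmd_space_def)

lemma sets_m [measurable_cong]: "sets m = sets borel"
  using radon by (simp add: radon_measure_def)

lemma space_m [simp]: "space m = UNIV"
  using sets_eq_imp_space_eq[OF sets_m] by simp

lemma emeasure_compact: "compact K \<Longrightarrow> emeasure m K < \<infinity>"
  using radon by (simp add: radon_measure_def)

lemma F_dense: "f \<in> F \<Longrightarrow> e > 0 \<Longrightarrow> \<exists>g\<in>F \<inter> C0 UNIV. q1 (\<lambda>x. f x - g x) < e"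
  using regular E1_norm_all_less[of "F \<inter> C0 UNIV" "\<lambda>g x. f x - g x"]
  unfolding regular_form_def by blast

lemma ess_support_subset:
  assumes "closed K" "AE x in m. x \<notin> K \<longrightarrow> f x = 0" shows "ess_support m f \<subseteq> K"
  using assms unfolding ess_support_def by (auto intro!: exI[of _ "- K"])

lemma compact_ess_support:
  assumes "compact K" "AE x in m. x \<notin> K \<longrightarrow> f x = 0" shows "compact (ess_support m f)"
proof -
  have "closed (ess_support m f)" unfolding ess_support_def by (auto intro!: open_Union)
  then show ?thesis
    using compact_Int_closed[OF assms(1), of "ess_support m f"]
      ess_support_subset[OF compact_imp_closed[OF assms(1)] assms(2)] by (simp add: Int_absorb1)
qed

lemma E_local_compact:
  assumes "f \<in> F" "g \<in> F" "compact K" "AE x in m. x \<notin> K \<longrightarrow> f x = 0"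
    "compact L" "AE x in m. x \<notin> L \<longrightarrow> g x = 0"
    "open U" "L \<subseteq> U" "AE x in m. x \<in> U \<longrightarrow> f x = c"
  shows "E f g = 0"
proof -
  have "ess_support m g \<subseteq> U"
    using ess_support_subset[OF compact_imp_closed[OF assms(5)] assms(6)] assms(8) by blast
  then show ?thesis
    using local assms(1,2,7,9) compact_ess_support[OF assms(3,4)] compact_ess_support[OF assms(5,6)]
    unfolding strongly_local_def by blast
qed

lemma compact_support_C0: "f \<in> C0 D \<Longrightarrow> compact (closure {x. f x \<noteq> 0})"
  by (simp add: C0_def compactly_in_def)

lemma F_on_iff: "f \<in> F_on m E F D \<longleftrightarrow> f \<in> F \<and> (\<forall>e>0. \<exists>g\<in>F \<inter> C0 D. q1 (\<lambda>x. f x - g x) < e)"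
  unfolding F_on_def using E1_norm_all_less[of "F \<inter> C0 D" "\<lambda>g x. f x - g x"] by simp

lemma F_on_F: "f \<in> F_on m E F D \<Longrightarrow> f \<in> F"
  by (simp add: F_on_iff)

lemma C0_in_F_on: assumes "f \<in> F" "f \<in> C0 D" shows "f \<in> F_on m E F D"
proof -
  have "q1 (\<lambda>x. f x - f x) = 0"
    using q1_scale[OF assms(1), of 0] by simp
  then show ?thesis using assms unfolding F_on_iff by force
qed

lemma F_on_mono: "D \<subseteq> D' \<Longrightarrow> F_on m E F D \<subseteq> F_on m E F D'"
  unfolding F_on_def using C0_mono[of D D'] by blast

lemma F_on_add:
  assumes "f \<in> F_on m E F D" "g \<in> F_on m E F D" shows "(\<lambda>x. f x + g x) \<in> F_on m E F D"
  unfolding F_on_iff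
proof (intro conjI allI impI)
  have F: "f \<in> F" "g \<in> F" using assms F_on_F by auto
  then show "(\<lambda>x. f x + g x) \<in> F" by (rule E.add_closed)
  fix e :: real assume "e > 0"
  then obtain f' g' where *: "f' \<in> F \<inter> C0 D" "g' \<in> F \<inter> C0 D"
      "q1 (\<lambda>x. f x - f' x) < e / 4" "q1 (\<lambda>x. g x - g' x) < e / 4"
    using assms unfolding F_on_iff by (meson divide_pos_pos zero_less_numeral)
  have "(\<lambda>x. (f x + g x) - (f' x + g' x)) = (\<lambda>x. (f x - f' x) + (g x - g' x))" by auto
  then have "q1 (\<lambda>x. (f x + g x) - (f' x + g' x)) < e"
    using q1_add_le[OF E.diff_closed[OF F(1), of f'] E.diff_closed[OF F(2), of g']] * by auto
  moreover have "(\<lambda>x. f' x + g' x) \<in> F \<inter> C0 D" using * C0_add E.add_closed by blast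
  ultimately show "\<exists>h\<in>F \<inter> C0 D. q1 (\<lambda>x. (f x + g x) - h x) < e" by (rule bexI)
qed

lemma F_on_closed:
  assumes "f \<in> F" "\<And>e. e > 0 \<Longrightarrow> \<exists>g\<in>F_on m E F D. q1 (\<lambda>x. f x - g x) < e"
  shows "f \<in> F_on m E F D"
  unfolding F_on_iff
proof (intro conjI allI impI assms(1))
  fix e :: real assume e: "e > 0"
  then obtain g where g: "g \<in> F_on m E F D" "q1 (\<lambda>x. f x - g x) < e / 4"
    using assms(2)[of "e / 4"] by auto
  then obtain h where h: "h \<in> F \<inter> C0 D" "q1 (\<lambda>x. g x - h x) < e / 4"
    using e unfolding F_on_iff by (meson divide_pos_pos zero_less_numeral)
  have "(\<lambda>x. f x - h x) = (\<lambda>x. (f x - g x) + (g x - h x))" by auto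
  then have "q1 (\<lambda>x. f x - h x) < e"
    using q1_add_le[OF E.diff_closed[OF assms(1) F_on_F[OF g(1)]] E.diff_closed[OF F_on_F[OF g(1)], of h]]
      g h by auto
  then show "\<exists>h\<in>F \<inter> C0 D. q1 (\<lambda>x. f x - h x) < e" using h by blast
qed

lemma F_on_scale: assumes f: "f \<in> F_on m E F D" shows "(\<lambda>x. c * f x) \<in> F_on m E F D"
  unfolding F_on_iff
proof (intro conjI allI impI)
  have F: "f \<in> F" using assms F_on_F by auto
  then show "(\<lambda>x. c * f x) \<in> F" by (rule E.scale_closed)
  fix e :: real assume "e > 0"
  then have "e / (c\<^sup>2 + 1) > 0" by (simp add: add_nonneg_pos)
  then obtain g where g: "g \<in> F" "g \<in> C0 D" "q1 (\<lambda>x. f x - g x) < e / (c\<^sup>2 + 1)"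
    using f unfolding F_on_iff by (metis IntE)
  have d: "(\<lambda>x. f x - g x) \<in> F" using F g by (intro E.diff_closed)
  have "(\<lambda>x. c * f x - c * g x) = (\<lambda>x. c * (f x - g x))" by (auto simp: algebra_simps)
  then have "q1 (\<lambda>x. c * f x - c * g x) = c\<^sup>2 * q1 (\<lambda>x. f x - g x)"
    using q1_scale[OF d] by simp
  also have "\<dots> \<le> (c\<^sup>2 + 1) * q1 (\<lambda>x. f x - g x)"
    using q1_nonneg[OF d] by (simp add: algebra_simps)
  also have "\<dots> < e" using g(3) by (simp add: pos_less_divide_eq add_nonneg_pos mult.commute)
  finally show "\<exists>h\<in>F \<inter> C0 D. q1 (\<lambda>x. c * f x - h x) < e"
    using g E.scale_closed[OF g(1), of c] C0_scale[OF g(2), of c]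
    by (intro bexI[of _ "\<lambda>x. c * g x"]) auto
qed

lemma F_on_diff: "f \<in> F_on m E F D \<Longrightarrow> g \<in> F_on m E F D \<Longrightarrow> (\<lambda>x. f x - g x) \<in> F_on m E F D"
  using F_on_add[of f D "\<lambda>x. (-1) * g x"] F_on_scale[of g D "-1"] by simp

lemma small_nsq_imp_AE_zero:
  assumes f: "f \<in> F" and A: "A \<in> sets borel"
    and ap: "\<And>e. e > 0 \<Longrightarrow> \<exists>g\<in>F. (AE x in m. x \<in> A \<longrightarrow> g x = 0) \<and> q1 (\<lambda>x. f x - g x) < e"
  shows "AE x in m. x \<in> A \<longrightarrow> f x = 0"
proof -
  let ?h = "\<lambda>x. if x \<in> A then f x else 0"
  have [measurable]: "A \<in> sets m" using A sets_m by simp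
  have h [measurable]: "?h \<in> borel_measurable m" using f by measurable
  have "nsq m ?h \<le> 0 + e" if "e > 0" for e
  proof -
    obtain g where g: "g \<in> F" "AE x in m. x \<in> A \<longrightarrow> g x = 0" "q1 (\<lambda>x. f x - g x) < e"
      using ap[OF \<open>e > 0\<close>] by blast
    have d: "(\<lambda>x. f x - g x) \<in> F" using f g(1) by (rule E.diff_closed)
    have "nsq m ?h \<le> nsq m (\<lambda>x. f x - g x)"
      by (rule nsq_mono[OF F_L2[OF d] h]) (use g(2) in \<open>eventually_elim, auto\<close>)
    then show ?thesis using nsq_le_q1[OF d] g(3) by simp
  qed
  then have "nsq m ?h \<le> 0" by (rule field_le_epsilon)
  then have "nsq m ?h = 0" using nsq_nonneg by (metis order_antisym)
  moreover have "?h \<in> L2 m" by (rule L2_bound[OF F_L2[OF f] h]) auto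
  ultimately have "AE x in m. ?h x = 0" using nsq_eq_0 by blast
  then show ?thesis by eventually_elim (auto split: if_splits)
qed

lemma F_on_outside:
  assumes f: "f \<in> F_on m E F D" and D: "open D"
  shows "AE x in m. x \<notin> D \<longrightarrow> f x = 0"
proof -
  have "AE x in m. x \<in> - D \<longrightarrow> f x = 0"
  proof (rule small_nsq_imp_AE_zero[OF F_on_F[OF f]])
    show "- D \<in> sets borel" using D by auto
    fix e :: real assume "e > 0"
    then obtain g where "g \<in> F" "g \<in> C0 D" "q1 (\<lambda>x. f x - g x) < e"
      using f unfolding F_on_iff by (metis IntE)
    then show "\<exists>g\<in>F. (AE x in m. x \<in> - D \<longrightarrow> g x = 0) \<and> q1 (\<lambda>x. f x - g x) < e"
      by (intro bexI[of _ g]) (auto simp: C0_outside)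
  qed
  then show ?thesis by simp
qed

text \<open>The form domain of \<open>D\<close> is hereditary: no regularity of \<open>f\<close> is required
  beyond domination by an element of the domain. If \<open>g\<close> and \<open>\<psi>\<close> are
  continuous approximations of \<open>f\<close> and \<open>\<phi>\<close>, then
  \<open>min g\<^sup>+ \<psi>\<^sup>+\<close> has compact support in \<open>D\<close>, bounded
  energy, and is close to \<open>f\<close> in \<open>L2\<close>.\<close>

lemma F_on_dominated:
  assumes f: "f \<in> F" and p: "\<phi> \<in> F_on m E F D"
    and ae: "AE x in m. 0 \<le> f x \<and> f x \<le> max (\<phi> x) 0"
  shows "f \<in> F_on m E F D"
proof -
  let ?S = "F \<inter> C0 D"
  have pF: "\<phi> \<in> F" using p by (rule F_on_F)
  define K where "K = 6 * (2 * E f f + 2) + 4 * (2 * E \<phi> \<phi> + 2)"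
  have mid: "(\<lambda>x. (g x + h x) / 2) \<in> ?S" if "g \<in> ?S" "h \<in> ?S" for g h
    using that C0_scale[OF C0_add[of g D h], of "1/2"] by (auto intro: E.mid_closed)
  have ap: "\<exists>w\<in>?S. nsq m (\<lambda>x. w x - f x) < d \<and> E w w \<le> K" if "d > 0" for d
  proof -
    define d' where "d' = min 1 (d / 4)"
    have d': "d' > 0" "d' \<le> 1" "d' \<le> d / 4" using that by (auto simp: d'_def)
    obtain g where g: "g \<in> F" "g \<in> C0 UNIV" "q1 (\<lambda>x. f x - g x) < d'"
      using F_dense[OF f d'(1)] by blast
    obtain \<psi> where psi: "\<psi> \<in> F" "\<psi> \<in> C0 D" "q1 (\<lambda>x. \<phi> x - \<psi> x) < d'"
      using p d'(1) unfolding F_on_iff by (metis IntE)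
    let ?w = "\<lambda>x. min (max (g x) 0) (max (\<psi> x) 0)"
    note gp = pos_part[OF g(1)] and pp = pos_part[OF psi(1)]
    note wF = F_min[OF gp(1) pp(1)]
    have wC: "?w \<in> C0 D"
      by (rule C0_bounded_support[OF psi(2)])
         (auto intro!: continuous_intros C0_continuous[OF g(2)] C0_continuous[OF psi(2)])
    have "E g g \<le> 2 * E f f + 2" "E \<psi> \<psi> \<le> 2 * E \<phi> \<phi> + 2"
      using E_near[OF f g(1)] E_near[OF pF psi(1)] g(3) psi(3) d' by auto
    then have wK: "E ?w ?w \<le> K" using wF(2) gp(2) pp(2) by (simp add: K_def)
    have df: "(\<lambda>x. f x - g x) \<in> F" "(\<lambda>x. \<phi> x - \<psi> x) \<in> F"
      using f g pF psi by (auto intro: E.diff_closed)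
    let ?a = "\<lambda>x. \<bar>f x - g x\<bar>" and ?b = "\<lambda>x. \<bar>\<phi> x - \<psi> x\<bar>"
    have La: "?a \<in> L2 m" "?b \<in> L2 m"
      using F_L2[OF df(1)] F_L2[OF df(2)] df by (auto simp: L2_def)
    have "nsq m (\<lambda>x. ?w x - f x) \<le> nsq m (\<lambda>x. ?a x + ?b x)"
    proof (rule nsq_mono[OF L2_add[OF La]])
      show "(\<lambda>x. ?w x - f x) \<in> borel_measurable m" using f g(1) psi(1) by measurable
      show "AE x in m. \<bar>?w x - f x\<bar> \<le> \<bar>?a x + ?b x\<bar>"
        using ae by eventually_elim (simp add: min_def max_def abs_if split: if_splits)
    qed
    also have "\<dots> \<le> 2 * nsq m ?a + 2 * nsq m ?b" by (rule nsq_add_le[OF La])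
    also have "\<dots> = 2 * nsq m (\<lambda>x. f x - g x) + 2 * nsq m (\<lambda>x. \<phi> x - \<psi> x)"
      by (simp add: nsq_def)
    also have "\<dots> < d"
      using nsq_le_q1[OF df(1)] nsq_le_q1[OF df(2)] g(3) psi(3) d' by linarith
    finally show ?thesis using wF(1) wC wK by (intro bexI[of _ ?w]) auto
  qed
  have "\<exists>w\<in>?S. q1 (\<lambda>x. f x - w x) < e" if "e > 0" for e
    by (rule weak_closure(2)[OF _ mid F_L2[OF f] ap that]) auto
  then show ?thesis using f by (simp add: F_on_iff)
qed

text \<open>Strong locality when only one of the two functions has compact support: \<open>k\<^sup>+\<close>
  is the \<open>L2\<close> limit of the compactly supported functions
  \<open>min k\<^sup>+ g\<^sup>+\<close>, which vanish wherever \<open>k\<close> does.\<close>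

lemma E_local_pos:
  assumes f: "f \<in> F" "compact K" "AE x in m. x \<notin> K \<longrightarrow> f x = 0"
    and k: "k \<in> F" and V: "open V" "K \<subseteq> V" "AE x in m. x \<in> V \<longrightarrow> k x = 0"
  shows "E f (\<lambda>x. max (k x) 0) = 0"
proof (rule E_zero_limit[OF f(1) pos_part(1)[OF k]])
  fix d :: real assume "d > 0"
  then have d': "min 1 d > 0" by simp
  obtain g where g: "g \<in> F" "g \<in> C0 UNIV" "q1 (\<lambda>x. k x - g x) < min 1 d"
    using F_dense[OF k d'] by blast
  note kp = pos_part[OF k] and gp = pos_part[OF g(1)]
  let ?w = "\<lambda>x. min (max (k x) 0) (max (g x) 0)"
  note wF = F_min[OF kp(1) gp(1)]
  have 1: "E ?w ?w \<le> 6 * E k k + 4 * (2 * E k k + 2)"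
    using wF(2) kp(2) gp(2) E_near[OF k g(1)] g(3) by simp
  have 2: "E f ?w = 0"
  proof -
    have "E ?w f = 0"
    proof (rule E_local_compact[OF wF(1) f(1) compact_support_C0[OF g(2)] _ f(2,3) V(1,2)])
      show "AE x in m. x \<notin> closure {x. g x \<noteq> 0} \<longrightarrow> ?w x = 0"
        by (rule AE_I2) (auto dest: eq_0_outside_support)
      show "AE x in m. x \<in> V \<longrightarrow> ?w x = 0" using V(3) by eventually_elim auto
    qed
    then show ?thesis using E.sym[OF wF(1) f(1)] by simp
  qed
  have df: "(\<lambda>x. k x - g x) \<in> F" using k g by (auto intro: E.diff_closed)
  have "nsq m (\<lambda>x. ?w x - max (k x) 0) \<le> nsq m (\<lambda>x. k x - g x)"
    by (rule nsq_mono[OF F_L2[OF df]]) (use k g(1) in \<open>auto simp: min_def max_def\<close>)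
  then have 3: "nsq m (\<lambda>x. ?w x - max (k x) 0) < d" using nsq_le_q1[OF df] g(3) by simp
  show "\<exists>w\<in>F. nsq m (\<lambda>x. w x - max (k x) 0) < d \<and> E w w \<le> 6 * E k k + 4 * (2 * E k k + 2) \<and> E f w = 0"
    using 1 2 3 by (intro bexI[OF _ wF(1)] conjI)
qed

lemma E_local:
  assumes f: "f \<in> F" "compact K" "AE x in m. x \<notin> K \<longrightarrow> f x = 0"
    and k: "k \<in> F" and V: "open V" "K \<subseteq> V" "AE x in m. x \<in> V \<longrightarrow> k x = 0"
  shows "E f k = 0"
proof -
  have k': "(\<lambda>x. - k x) \<in> F" using F_mult[OF k, of "-1"] by simp
  have V': "AE x in m. x \<in> V \<longrightarrow> - k x = 0" using V(3) by simp
  have "k = (\<lambda>x. max (k x) 0 - max (- k x) 0)" by (auto simp: max_def)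
  then have "E f k = E f (\<lambda>x. max (k x) 0) - E f (\<lambda>x. max (- k x) 0)"
    using E.diff_right[OF pos_part(1)[OF k] pos_part(1)[OF k'] f(1)] by simp
  then show ?thesis using E_local_pos[OF f k V] E_local_pos[OF f k' V(1,2) V'] by simp
qed

text \<open>The definition of harmonicity quantifies over all local representatives; by locality a single
  global one suffices.\<close>

lemma harmonic_of_orthogonal:
  assumes h: "h \<in> F" and U: "open U"
    and orth: "\<And>f. f \<in> F \<Longrightarrow> f \<in> C0 U \<Longrightarrow> E h f = 0"
  shows "harmonic m E F U h"
  unfolding harmonic_def
proof (intro conjI ballI allI impI)
  have hL: "integrable m (\<lambda>x. (h x)\<^sup>2)" using F_L2[OF h] by (simp add: L2_def)
  have "set_integrable m K (\<lambda>x. (h x)\<^sup>2)" if "compact K" for K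
    using hL sets_m that unfolding set_integrable_def
    by (intro integrable_mult_indicator) (auto intro: borel_compact)
  moreover have "h \<in> borel_measurable (restrict_space m U)"
    using h by (intro measurable_restrict_space1) (rule F_meas)
  ultimately show "h \<in> F_loc m F U" using h by (auto simp: F_loc_def L2_loc_def)
  fix f V h'
  assume f: "f \<in> F \<inter> C0 U" and h': "h' \<in> F" and
    *: "open V \<and> V \<Subset> U \<and> closure {x. f x \<noteq> 0} \<subseteq> V \<and> (AE x in m. x \<in> V \<longrightarrow> h x = h' x)"
  have d: "(\<lambda>x. h x - h' x) \<in> F" using h h' by (rule E.diff_closed)
  have "E f (\<lambda>x. h x - h' x) = 0"
  proof (rule E_local[OF _ compact_support_C0[of f U] _ d, where V=V])
    show "AE x in m. x \<notin> closure {x. f x \<noteq> 0} \<longrightarrow> f x = 0"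
      by (rule AE_I2) (auto dest: eq_0_outside_support)
    have "AE x in m. x \<in> V \<longrightarrow> h x = h' x" using * by blast
    then show "AE x in m. x \<in> V \<longrightarrow> h x - h' x = 0" by eventually_elim auto
  qed (use f * in auto)
  then show "E f h' = 0" using E.diff_right[OF h h'] f orth[of f] E.sym[OF h, of f] by auto
qed

lemma harmonic_subset:
  assumes h: "harmonic m E F U h" and V: "V \<subseteq> U" "V \<in> sets borel"
  shows "harmonic m E F V h"
  unfolding harmonic_def
proof (intro conjI ballI allI impI)
  have *: "h \<in> F_loc m F U" using h by (simp add: harmonic_def)
  have "h \<in> borel_measurable (restrict_space m V)"
    using * by (intro measurable_restrict_mono[OF _ V(1)]) (simp add: F_loc_def L2_loc_def)
  then show "h \<in> F_loc m F V"
    using * V by (auto simp: F_loc_def L2_loc_def intro: compactly_in_mono)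
  fix f W h'
  assume "f \<in> F \<inter> C0 V" "h' \<in> F"
    "open W \<and> W \<Subset> V \<and> closure {x. f x \<noteq> 0} \<subseteq> W \<and> (AE x in m. x \<in> W \<longrightarrow> h x = h' x)"
  then show "E f h' = 0"
    using h V C0_mono[of V U] compactly_in_mono[of W W V U] unfolding harmonic_def by blast
qed

end

section \<open>Length spaces: chains, compactness of balls and cutoff functions\<close>

lemma steps_dist_le:
  fixes p :: "nat \<Rightarrow> 'a::metric_space"
  assumes "\<And>k. k < n \<Longrightarrow> dist (p k) (p (Suc k)) \<le> c" "i \<le> j" "j \<le> n"
  shows "dist (p i) (p j) \<le> real (j - i) * c"
  using assms(2,3)
proof (induction j rule: dec_induct)
  case base
  then show ?case by simp
next
  case (step k)
  have "dist (p i) (p (Suc k)) \<le> dist (p i) (p k) + dist (p k) (p (Suc k))" by (rule dist_triangle)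
  also have "\<dots> \<le> real (k - i) * c + c"
    using step assms(1)[of k] by (intro add_mono) auto
  also have "\<dots> = real (Suc k - i) * c" using step by (simp add: Suc_diff_le algebra_simps)
  finally show ?case .
qed

text \<open>A metric measure Dirichlet space whose metric is a length metric.\<close>

locale length_mmd = fixes m :: "'a::polish_space measure" and E :: "'a form" and F :: "('a \<Rightarrow> real) set"
  assumes length_mmd: "length_mmd_space m E F"
begin

sublocale mmd m E F
  using length_mmd by unfold_locales (simp add: length_mmd_space_def)

lemma intermediate_point:
  fixes x y :: 'a
  assumes a: "0 \<le> a" "a \<le> dist x y" and b: "dist x y < a + b"
  shows "\<exists>p. dist x p = a \<and> dist p y \<le> b"
proof -
  have "ennreal (dist x y) < ennreal (a + b)" using b by (intro ennreal_lessI) (auto intro: le_less_trans[OF zero_le_dist])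
  moreover have "ennreal (dist x y) =
      (INF \<gamma> \<in> {\<gamma>. path \<gamma> \<and> pathstart \<gamma> = x \<and> pathfinish \<gamma> = y}. path_length \<gamma>)"
    using length_mmd by (simp add: length_mmd_space_def)
  ultimately obtain \<gamma> where g: "path \<gamma>" "\<gamma> 0 = x" "\<gamma> 1 = y" "path_length \<gamma> < ennreal (a + b)"
    by (auto simp: INF_less_iff pathstart_def pathfinish_def)
  have "continuous_on {0..1} (\<lambda>t. dist x (\<gamma> t))"
    using g(1) by (auto simp: path_def intro!: continuous_intros)
  then obtain t where t: "0 \<le> t" "t \<le> 1" "dist x (\<gamma> t) = a"
    using IVT'[of "\<lambda>t. dist x (\<gamma> t)" 0 a 1] a g(2,3) by auto
  define \<tau> where "\<tau> i = (if i = 0 then 0 else if i = Suc 0 then t else 1)" for i :: nat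
  have "(\<Sum>i<2. ennreal (dist (\<gamma> (\<tau> i)) (\<gamma> (\<tau> (Suc i))))) \<le> path_length \<gamma>"
    unfolding path_length_def
    using t by (intro SUP_upper2[of "(2, \<tau>)"]) (auto simp: \<tau>_def mono_on_def)
  moreover have "(\<Sum>i<2. ennreal (dist (\<gamma> (\<tau> i)) (\<gamma> (\<tau> (Suc i))))) = ennreal (a + dist (\<gamma> t) y)"
    using g t a by (simp add: \<tau>_def numeral_2_eq_2 ennreal_plus)
  ultimately have "ennreal (a + dist (\<gamma> t) y) < ennreal (a + b)" using g(4) by (metis le_less_trans)
  then have "a + dist (\<gamma> t) y < a + b" using a by (subst (asm) ennreal_less_iff) auto
  then show ?thesis using t(3) by (intro exI[of _ "\<gamma> t"]) auto
qed

lemma chain_exists: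
  fixes x y :: 'a
  assumes "0 < c" "dist x y < real n * c"
  shows "\<exists>p. p 0 = x \<and> p n = y \<and> (\<forall>k<n. dist (p k) (p (Suc k)) \<le> c)"
  using assms(2)
proof (induction n arbitrary: x)
  case 0
  then show ?case by simp
next
  case (Suc n)
  show ?case
  proof (cases "dist x y \<le> c")
    case True
    then show ?thesis using assms(1)
      by (intro exI[of _ "\<lambda>k. if k = 0 then x else y"]) auto
  next
    case False
    define b where "b = (dist x y - c + real n * c) / 2"
    have "dist x y < c + real n * c" using Suc.prems by (simp add: algebra_simps)
    then have b: "dist x y < c + b" "b < real n * c" unfolding b_def by argo+
    obtain q where q: "dist x q = c" "dist q y \<le> b"
      using intermediate_point[of c x y b] False b assms(1) by auto
    obtain p where p: "p 0 = q" "p n = y" "\<forall>k<n. dist (p k) (p (Suc k)) \<le> c"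
      using Suc.IH[of q] q b by auto
    define p' where "p' k = (case k of 0 \<Rightarrow> x | Suc j \<Rightarrow> p j)" for k
    have "dist (p' k) (p' (Suc k)) \<le> c" if "k < Suc n" for k
      using that q p by (cases k) (auto simp: p'_def)
    then show ?thesis using p by (intro exI[of _ p']) (auto simp: p'_def)
  qed
qed

text \<open>The next three lemmas are the Hopf-Rinow theorem: closed balls of a complete, locally compact
  length space are compact. The set of radii with compact balls is open and closed.\<close>

lemma compact_cball_extend:
  fixes x :: 'a
  assumes "compact (cball x r)" "0 \<le> r"
  shows "\<exists>e>0. compact (cball x (r + e))"
proof -
  have "locally_compact_space (euclidean :: 'a topology)" using mmd by (simp add: mmd_space_def)
  then have "\<forall>y::'a. \<exists>U K. open U \<and> compact K \<and> y \<in> U \<and> U \<subseteq> K"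
    by (simp add: locally_compact_space_def)
  then obtain U K where UK: "\<And>y::'a. open (U y)" "\<And>y. compact (K y)" "\<And>y. y \<in> U y" "\<And>y. U y \<subseteq> K y"
    by metis
  obtain T where T: "T \<subseteq> cball x r" "finite T" "cball x r \<subseteq> (\<Union>y\<in>T. U y)"
    using compactE_image[OF assms(1), of "cball x r" U] UK(1,3) by (metis UN_iff subsetI)
  have cK: "compact (\<Union>y\<in>T. K y)" using T(2) UK(2) by auto
  have "cball x r \<subseteq> \<Union>{\<Union>y\<in>T. U y}" "\<And>G. G \<in> {\<Union>y\<in>T. U y} \<Longrightarrow> open G"
    using T(3) UK(1) by auto
  from Heine_Borel_lemma[OF assms(1) this] obtain d where
    d: "d > 0" "\<And>q. q \<in> cball x r \<Longrightarrow> ball q d \<subseteq> (\<Union>y\<in>T. U y)" by (metis singletonD)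
  have "cball x (r + d / 4) \<subseteq> (\<Union>y\<in>T. U y)"
  proof
    fix y assume y: "y \<in> cball x (r + d / 4)"
    have "\<exists>q\<in>cball x r. dist q y < d"
    proof (cases "dist x y \<le> r")
      case True
      then show ?thesis using d(1) by (intro bexI[of _ y]) auto
    next
      case False
      then obtain q where "dist x q = r" "dist q y \<le> d / 2"
        using intermediate_point[of r x y "d / 2"] y d(1) assms(2) by auto
      then show ?thesis using d(1) by (intro bexI[of _ q]) auto
    qed
    then show "y \<in> (\<Union>y\<in>T. U y)" using d(2) by fastforce
  qed
  then have sub: "cball x (r + d / 4) \<subseteq> (\<Union>y\<in>T. K y)" using UK(4) by blast
  have "compact (cball x (r + d / 4))"
    using compact_Int_closed[OF cK closed_cball[of x "r + d / 4"]] sub by (simp add: Int_absorb1)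
  then show ?thesis using d(1) by (intro exI[of _ "d / 4"]) auto
qed

lemma compact_cball_limit:
  fixes x :: 'a
  assumes "\<And>s. s < r \<Longrightarrow> compact (cball x s)" "0 < r"
  shows "compact (cball x r)"
  unfolding compact_eq_totally_bounded
proof (intro conjI allI impI)
  show "complete (cball x r)" by (simp add: complete_eq_closed)
  fix e :: real assume e: "e > 0"
  define s where "s = max 0 (r - e / 4)"
  have s: "s < r" "0 \<le> s" "r - s \<le> e / 4" using assms(2) e by (auto simp: s_def max_def)
  obtain k where k: "finite k" "cball x s \<subseteq> (\<Union>y\<in>k. ball y (e / 2))"
    using assms(1)[OF s(1)] e unfolding compact_eq_totally_bounded by (meson half_gt_zero)
  have "cball x r \<subseteq> (\<Union>y\<in>k. ball y e)"
  proof
    fix y assume y: "y \<in> cball x r"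
    have "\<exists>q\<in>cball x s. dist q y < e / 2"
    proof (cases "dist x y \<le> s")
      case True
      then show ?thesis using e by (intro bexI[of _ y]) auto
    next
      case False
      then obtain q where "dist x q = s" "dist q y \<le> e / 3"
        using intermediate_point[of s x y "e / 3"] y s e by auto
      then show ?thesis using e by (intro bexI[of _ q]) auto
    qed
    then obtain q z where "dist q y < e / 2" "z \<in> k" "dist z q < e / 2" using k(2) by fastforce
    then have "dist z y < e" using dist_triangle[of z y q] by simp
    then show "y \<in> (\<Union>y\<in>k. ball y e)" using \<open>z \<in> k\<close> by auto
  qed
  then show "\<exists>k. finite k \<and> cball x r \<subseteq> (\<Union>y\<in>k. ball y e)" using k(1) by blast
qed

lemma compact_cball: "compact (cball (x::'a) R)"
proof (rule ccontr)
  assume nc: "\<not> compact (cball x R)"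
  define T where "T = {r. \<not> compact (cball x r)}"
  have sub: "compact (cball x r)" if "compact (cball x s)" "r \<le> s" for r s
    using compact_Int_closed[OF that(1) closed_cball[of x r]] subset_cball[OF that(2), of x]
    by (simp add: Int_absorb1)
  have c0: "compact (cball x r)" if "r \<le> 0" for r
    using sub[OF _ that] by simp
  have bdd: "bdd_below T" unfolding T_def by (rule bdd_belowI[of _ 0]) (use c0 in \<open>simp, meson nle_le\<close>)
  have T0: "0 \<le> r" if "r \<in> T" for r using that c0[of r] by (force simp: T_def)
  have ne: "T \<noteq> {}" using nc by (auto simp: T_def)
  define s where "s = Inf T"
  have less: "compact (cball x r)" if "r < s" for r
    using cInf_lower[OF _ bdd, of r] that by (force simp: s_def T_def)
  have s0: "0 \<le> s" unfolding s_def using T0 ne by (intro cInf_greatest)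
  have cs: "compact (cball x s)"
    using compact_cball_limit[OF less] c0[of s] s0 by (cases "s = 0") auto
  then obtain e where e: "e > 0" "compact (cball x (s + e))" using compact_cball_extend s0 by blast
  obtain r where r: "r \<in> T" "r < s + e"
    using cInf_lessD[OF ne, of "s + e"] e(1) by (auto simp: s_def)
  then show False using sub[OF e(2), of r] by (simp add: T_def)
qed

lemma compactly_in_ball:
  assumes "A \<subseteq> cball (x::'a) r" "cball x r \<subseteq> D" shows "A \<Subset> D"
proof -
  have "cball x r \<Subset> D" using assms(2) compact_cball by (simp add: compactly_in_def)
  then show ?thesis using assms(1) compactly_in_mono by blast
qed

lemma cutoff_exists:
  fixes z :: 'a
  assumes r: "r1 < r2"
  shows "\<exists>\<phi>\<in>F \<inter> C0 (ball z r2). \<forall>x\<in>cball z r1. \<phi> x = 1"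
proof -
  define r3 where "r3 = (r1 + r2) / 2"
  have r3: "r1 < r3" "r3 < r2" using r by (auto simp: r3_def)
  \<comment> \<open>An approximation of \<open>\<psi>\<close> with error less than \<open>1\<close> exceeds \<open>2\<close> on the inner ball and is below \<open>1\<close> outside
    \<open>cball z r3\<close>; cutting it between the levels \<open>1\<close> and \<open>2\<close> gives \<open>\<phi>\<close>.\<close>
  define \<psi> where "\<psi> x = max 0 (min 3 (3 / (r3 - r1) * (r3 - dist z x)))" for x
  have psi1: "\<psi> x = 3" if "x \<in> cball z r1" for x
  proof -
    have "3 / (r3 - r1) * (r3 - r1) \<le> 3 / (r3 - r1) * (r3 - dist z x)"
      using that r3 by (intro mult_left_mono) auto
    moreover have "3 / d * d = 3" if "d > 0" for d :: real using that by simp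
    from this[of "r3 - r1"] have "3 / (r3 - r1) * (r3 - r1) = 3" using r3 by auto
    ultimately have "3 \<le> 3 / (r3 - r1) * (r3 - dist z x)" by linarith
    then show ?thesis unfolding \<psi>_def by simp
  qed
  have psi0: "\<psi> x = 0" if "x \<notin> cball z r3" for x
  proof -
    have "3 / (r3 - r1) * (r3 - dist z x) \<le> 0"
      using that r3 by (intro mult_nonneg_nonpos) auto
    then show ?thesis unfolding \<psi>_def by simp
  qed
  have "continuous_on UNIV \<psi>" unfolding \<psi>_def by (intro continuous_intros)
  moreover have "{x. \<psi> x \<noteq> 0} \<Subset> UNIV"
    by (rule compactly_in_ball[of _ z r3]) (use psi0 in blast)+
  ultimately have "\<psi> \<in> C0 UNIV" by (simp add: C0_def)
  then obtain g where g: "g \<in> F" "g \<in> C0 UNIV" "\<And>x. \<bar>\<psi> x - g x\<bar> < 1"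
    using regular unfolding regular_form_def by (metis IntE zero_less_one)
  define \<phi> where "\<phi> x = min (max (g x) 0) 2 - min (max (g x) 0) 1" for x
  have "\<phi> \<in> F" unfolding \<phi>_def by (intro E.diff_closed truncation(1) g) auto
  moreover have "{x. \<phi> x \<noteq> 0} \<subseteq> cball z r3"
  proof
    fix x assume "x \<in> {x. \<phi> x \<noteq> 0}"
    then have "g x > 1" by (auto simp: \<phi>_def min_def max_def split: if_splits)
    then have "\<psi> x \<noteq> 0" using g(3)[of x] by auto
    then show "x \<in> cball z r3" using psi0 by blast
  qed
  then have "{x. \<phi> x \<noteq> 0} \<Subset> ball z r2" by (rule compactly_in_ball) (use r3 in auto)
  moreover have "continuous_on UNIV \<phi>" unfolding \<phi>_def by (intro continuous_intros C0_continuous[OF g(2)])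
  moreover have "\<phi> x = 1" if "x \<in> cball z r1" for x
    using psi1[OF that] g(3)[of x] by (auto simp: \<phi>_def)
  ultimately show ?thesis by (intro bexI[of _ \<phi>]) (auto simp: C0_def)
qed

lemma open_not_AE_avoided:
  assumes "open U" "a \<in> U" shows "\<not> (AE x in m. x \<notin> U)"
proof
  assume "AE x in m. x \<notin> U"
  moreover have "U \<in> sets m" using assms(1) sets_m by auto
  ultimately have "emeasure m U = 0" by (simp add: AE_iff_measurable[of U])
  then show False using open_pos[OF assms(1)] assms(2) by auto
qed

end

section \<open>Harnack chains\<close>

text \<open>The elliptic Harnack inequality, with its constants fixed.\<close>

locale harnack = length_mmd + fixes A C :: real
  assumes A: "1 < A" and C: "1 < C"
    and ehi: "\<And>x R h. 0 < R \<Longrightarrow> harmonic m E F (ball x (A * R)) h \<Longrightarrow>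
           (\<forall>y\<in>ball x (A * R). 0 \<le> h y) \<Longrightarrow>
           esssup (restrict_space m (ball x R)) (\<lambda>y. ereal (h y))
             \<le> ereal C * essinf (restrict_space m (ball x R)) (\<lambda>y. ereal (h y))"
begin

text \<open>The Harnack inequality without essential bounds: if a nonnegative harmonic function is not a.e.
  below \<open>c\<close> on a ball, it is a.e. at least \<open>c / C\<close> there.\<close>

lemma harnack_AE:
  assumes R: "0 < R" and h: "harmonic m E F (ball x (A * R)) h" "\<forall>y\<in>ball x (A * R). 0 \<le> h y"
    and c: "\<not> (AE y in m. y \<in> ball x R \<longrightarrow> h y < c)"
  shows "AE y in m. y \<in> ball x R \<longrightarrow> c / C \<le> h y"
proof -
  let ?M = "restrict_space m (ball x R)" and ?f = "\<lambda>y. ereal (h y)"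
  have iff: "(AE y in ?M. P y) \<longleftrightarrow> (AE y in m. y \<in> ball x R \<longrightarrow> P y)" for P
    by (rule AE_restrict_space_iff) (simp add: sets_m)
  have "ereal c \<le> esssup ?M ?f"
  proof (rule ccontr)
    assume "\<not> ereal c \<le> esssup ?M ?f"
    then have "AE y in ?M. h y < c"
      using esssup_AE[of ?f ?M] by (auto elim!: eventually_mono dest: le_less_trans simp: not_le)
    then show False using c by (simp add: iff)
  qed
  then have le: "ereal c \<le> ereal C * essinf ?M ?f" using ehi[OF R h] by (rule order_trans)
  have "AE y in ?M. essinf ?M ?f \<le> ?f y"
    using esssup_AE[of "\<lambda>y. - ?f y" ?M]
    by (auto simp: essinf_def ereal_uminus_le_reorder elim!: eventually_mono)
  then have "AE y in ?M. c / C \<le> h y"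
  proof eventually_elim
    case (elim y)
    have "ereal c \<le> ereal C * ereal (h y)"
      using le ereal_mult_left_mono[OF elim, of "ereal C"] C by (meson ereal_less_eq(5) less_imp_le order_trans zero_less_one)
    then show ?case using C by (simp add: pos_divide_le_eq mult.commute)
  qed
  then show ?thesis by (simp add: iff)
qed

text \<open>The constant lost along a chain of balls of radius \<open>s\<close> that joins points at distance
  at most \<open>L s\<close>. The steps have length at most \<open>s / 2\<close>, so there are at
  most \<open>2 L + 1\<close> of them, hence at most \<open>\<lceil>2 L\<rceil> + 2\<close> balls.\<close>

definition chain_const :: "real \<Rightarrow> real" where
  "chain_const L = C ^ (nat \<lceil>2 * L\<rceil> + 2)"

lemma chain_const_ge_1: "1 \<le> chain_const L"
  using C unfolding chain_const_def by (intro one_le_power) simp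

text \<open>Every centre \<open>p\<close> of the chain satisfies
  \<open>dist a p + dist p b \<le> dist a b + s\<close>, so it is enough that \<open>U\<close>
  contains the balls around such almost intermediate points.\<close>

lemma harnack_chain:
  assumes u: "harmonic m E F U u" "\<forall>y\<in>U. 0 \<le> u y" and U: "open U" and s: "0 < s"
    and clear: "\<And>p. dist a p + dist p b \<le> dist a b + s \<Longrightarrow> ball p (A * s) \<subseteq> U"
    and L: "dist a b \<le> L * s" and c: "0 \<le> c"
    and start: "\<not> (AE y in m. y \<in> ball a s \<longrightarrow> u y < c)"
  shows "AE y in m. y \<in> ball b s \<longrightarrow> c / chain_const L \<le> u y"
proof -
  define n where "n = nat \<lfloor>2 * dist a b / s\<rfloor> + 1"
  have fl: "real n \<le> 2 * dist a b / s + 1" "2 * dist a b / s < real n"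
    using s by (auto simp: n_def) linarith+
  then have n: "dist a b < real n * (s / 2)" "real n * (s / 2) \<le> dist a b + s / 2"
    using s by (auto simp: field_simps)
  have nL: "n + 1 \<le> nat \<lceil>2 * L\<rceil> + 2"
  proof -
    have "2 * dist a b / s \<le> 2 * L" using L s by (simp add: field_simps)
    then have "\<lfloor>2 * dist a b / s\<rfloor> \<le> \<lceil>2 * L\<rceil>" by linarith
    then show ?thesis by (simp add: n_def)
  qed
  obtain p where p: "p 0 = a" "p n = b" "\<forall>k<n. dist (p k) (p (Suc k)) \<le> s / 2"
    using chain_exists[OF _ n(1)] s by auto
  have sub: "ball (p k) (A * s) \<subseteq> U" if "k \<le> n" for k
  proof (rule clear)
    have "dist a (p k) \<le> real k * (s / 2)" "dist (p k) b \<le> real (n - k) * (s / 2)"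
      using steps_dist_le[of n p "s / 2" 0 k] steps_dist_le[of n p "s / 2" k n] p that by auto
    then have "dist a (p k) + dist (p k) b \<le> real n * (s / 2)"
      using that by (simp add: of_nat_diff algebra_simps)
    then show "dist a (p k) + dist (p k) b \<le> dist a b + s" using n s by simp
  qed
  have H: "AE y in m. y \<in> ball (p k) s \<longrightarrow> c' / C \<le> u y"
    if "k \<le> n" "\<not> (AE y in m. y \<in> ball (p k) s \<longrightarrow> u y < c')" for k c'
    by (rule harnack_AE[OF s harmonic_subset[OF u(1) sub[OF that(1)]] _ that(2)])
       (use sub[OF that(1)] u(2) in auto)
  have "AE y in m. y \<in> ball (p k) s \<longrightarrow> c / C ^ (k + 1) \<le> u y" if "k \<le> n" for k
    using that
  proof (induction k)
    case 0
    then show ?case using H[of 0 c] start p(1) by simp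
  next
    case (Suc k)
    have "\<not> (AE y in m. y \<in> ball (p (Suc k)) s \<longrightarrow> u y < c / C ^ (k + 1))"
    proof
      assume "AE y in m. y \<in> ball (p (Suc k)) s \<longrightarrow> u y < c / C ^ (k + 1)"
      moreover have "AE y in m. y \<in> ball (p k) s \<longrightarrow> c / C ^ (k + 1) \<le> u y"
        using Suc by simp
      ultimately have "AE y in m. y \<notin> ball (p k) s \<inter> ball (p (Suc k)) s"
        by eventually_elim auto
      moreover have "p (Suc k) \<in> ball (p k) s \<inter> ball (p (Suc k)) s"
        using p(3)[rule_format, of k] Suc.prems s by simp
      ultimately show False
        using open_not_AE_avoided[of "ball (p k) s \<inter> ball (p (Suc k)) s"] by blast
    qed
    from H[OF Suc.prems this] show ?case by (simp add: field_simps)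
  qed
  from this[of n] have "AE y in m. y \<in> ball b s \<longrightarrow> c / C ^ (n + 1) \<le> u y" using p(2) by simp
  moreover have "c / chain_const L \<le> c / C ^ (n + 1)"
    unfolding chain_const_def using nL C c
    by (intro divide_left_mono power_increasing) auto
  ultimately show ?thesis by (auto elim!: eventually_mono)
qed

lemma harnack_chain_continuous:
  assumes u: "harmonic m E F U u" "\<forall>y\<in>U. 0 \<le> u y" and U: "open U" and s: "0 < s"
    and clear: "\<And>p. dist a p + dist p b \<le> dist a b + s \<Longrightarrow> ball p (A * s) \<subseteq> U"
    and L: "dist a b \<le> L * s" and cont: "continuous_on U u"
  shows "u a \<le> chain_const L * u b"
proof (rule ccontr)
  let ?H = "chain_const L"
  have H: "?H > 0" using chain_const_ge_1[of L] by simp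
  assume "\<not> u a \<le> ?H * u b"
  then obtain c where c: "?H * u b < c" "c < u a" using dense[of "?H * u b" "u a"] by (auto simp: not_le)
  have "ball a (A * s) \<subseteq> U" "ball b (A * s) \<subseteq> U" using clear[of a] clear[of b] s by auto
  then have ab: "a \<in> U" "b \<in> U" using A s by auto
  then have "0 \<le> c" using c(1) u(2) H by (smt (verit) mult_nonneg_nonneg)
  have o1: "open {y \<in> U. c < u y}" "open {y \<in> U. u y < c / ?H}"
    using continuous_open_preimage[OF cont U open_greaterThan[of c]]
      continuous_open_preimage[OF cont U open_lessThan[of "c / ?H"]]
    by (simp_all add: vimage_def Int_def Collect_conj_eq[symmetric] greaterThan_def lessThan_def)
  have "\<not> (AE y in m. y \<in> ball a s \<longrightarrow> u y < c)"
  proof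
    assume "AE y in m. y \<in> ball a s \<longrightarrow> u y < c"
    then have "AE y in m. y \<notin> ball a s \<inter> {y \<in> U. c < u y}" by eventually_elim auto
    moreover have "a \<in> ball a s \<inter> {y \<in> U. c < u y}" using ab c s by simp
    ultimately show False using open_not_AE_avoided open_Int[OF open_ball o1(1)] by blast
  qed
  then have "AE y in m. y \<in> ball b s \<longrightarrow> c / ?H \<le> u y"
    using harnack_chain[OF u U s _ L \<open>0 \<le> c\<close>] clear by blast
  then have "AE y in m. y \<notin> ball b s \<inter> {y \<in> U. u y < c / ?H}"
    by eventually_elim auto
  moreover have "u b < c / ?H" using c(1) H by (simp add: pos_less_divide_eq mult.commute)
  then have "b \<in> ball b s \<inter> {y \<in> U. u y < c / ?H}" using ab s by simp
  ultimately show False using open_not_AE_avoided open_Int[OF open_ball o1(2)] by blast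
qed

end

section \<open>Green functions and potentials\<close>

context mmd
begin

lemma zero_F: "(\<lambda>x. 0) \<in> F" and zero_C0: "(\<lambda>x. 0) \<in> C0 (D :: 'a set)"
proof -
  show z: "(\<lambda>x. 0) \<in> C0 (D :: 'a set)" for D by (simp add: C0_def compactly_in_def)
  obtain g where "g \<in> F" using regular z[of UNIV] unfolding regular_form_def by (metis IntE zero_less_one)
  then show "(\<lambda>x. 0) \<in> F" by (rule F_zero)
qed

lemma F_on_nonempty: "F_on m E F D \<noteq> {}"
  using C0_in_F_on[OF zero_F zero_C0] by blast

lemma poincare_exists:
  assumes "lambda_min m E F D > 0"
  shows "\<exists>K. \<forall>f\<in>F_on m E F D. nsq m f \<le> K * E f f"
proof -
  obtain l where l: "0 < ereal l" "ereal l < lambda_min m E F D"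
    using ereal_dense2[OF assms] by blast
  have "nsq m f \<le> (1 / l) * E f f" if f: "f \<in> F_on m E F D" for f
  proof (cases "norm2 m f = 0")
    case True
    then show ?thesis using E.nonneg[OF F_on_F[OF f]] l norm2_power2[of m f] by simp
  next
    case False
    then have "lambda_min m E F D \<le> ereal (E f f / (norm2 m f)\<^sup>2)"
      unfolding lambda_min_def using f by (intro INF_lower) auto
    then have "l \<le> E f f / nsq m f" using l(2) by (metis ereal_less_eq(3) less_imp_le order_trans norm2_power2)
    moreover have "nsq m f > 0" using False norm2_power2[of m f] by (metis zero_less_power2)
    ultimately show ?thesis using l(1) by (simp add: field_simps)
  qed
  then show ?thesis by blast
qed

text \<open>The Green potential of a set, from the Riesz representation of integration over \<open>B\<close>.\<close>

lemma potential_exists: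
  assumes l: "lambda_min m E F D > 0" and g: "green_function m E F D g" and D: "open D"
    and B: "B \<in> sets borel" "B \<subseteq> D" "emeasure m B < \<infinity>"
  shows "\<exists>u\<in>F_on m E F D. (\<forall>\<phi>\<in>F_on m E F D. E u \<phi> = (\<integral>x. indicator B x * \<phi> x \<partial>m)) \<and>
    (AE x in m. x \<in> D \<longrightarrow> set_integrable m D (\<lambda>y. g x y * indicator B y) \<and>
       u x = (LINT y:D|m. g x y * indicator B y))"
proof -
  let ?f = "indicator B :: 'a \<Rightarrow> real"
  have Bm [measurable]: "B \<in> sets m" using B(1) sets_m by simp
  have sq: "(\<lambda>x. (?f x)\<^sup>2) = ?f" by (auto simp: indicator_def)
  have fL: "?f \<in> L2 m" using B(3) by (auto simp: L2_def sq)
  then have fD: "?f \<in> L2_on m D" using B(2) by (auto simp: L2_on_def indicator_def)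
  obtain K where K: "\<forall>f\<in>F_on m E F D. nsq m f \<le> K * E f f" using poincare_exists[OF l] by blast
  have int: "integrable m (\<lambda>x. ?f x * \<phi> x)" if "\<phi> \<in> F_on m E F D" for \<phi>
    using L2_integrable_prod[OF fL F_L2[OF F_on_F[OF that]]] .
  have "\<exists>u\<in>F_on m E F D. \<forall>\<phi>\<in>F_on m E F D. E u \<phi> = (\<integral>x. ?f x * \<phi> x \<partial>m)"
  proof (rule riesz[where K=K and L="nsq m ?f * K"])
    show "F_on m E F D \<subseteq> F" using F_on_F by blast
    show "f \<in> F_on m E F D" if "f \<in> F" "\<And>e. e > 0 \<Longrightarrow> \<exists>g\<in>F_on m E F D. q1 (\<lambda>x. f x - g x) < e" for f
      using F_on_closed that by blast
    show "(\<integral>x. ?f x * (f x + g x) \<partial>m) = (\<integral>x. ?f x * f x \<partial>m) + (\<integral>x. ?f x * g x \<partial>m)"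
      if "f \<in> F_on m E F D" "g \<in> F_on m E F D" for f g
      using int[OF that(1)] int[OF that(2)] by (simp add: distrib_left)
    show "(\<integral>x. ?f x * (c * f x) \<partial>m) = c * (\<integral>x. ?f x * f x \<partial>m)" for c f
      by (simp add: mult.left_commute)
    show "(\<integral>x. ?f x * f x \<partial>m)\<^sup>2 \<le> nsq m ?f * K * E f f" if "f \<in> F_on m E F D" for f
    proof -
      have "(\<integral>x. ?f x * f x \<partial>m)\<^sup>2 \<le> nsq m ?f * nsq m f"
        using psd_form.cauchy_schwarz[OF psd_form_L2 fL F_L2[OF F_on_F[OF that]]] by (simp add: nsq_alt)
      also have "\<dots> \<le> nsq m ?f * (K * E f f)" using K that by (intro mult_left_mono) auto
      finally show ?thesis by (simp add: mult.assoc)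
    qed
  qed (use K F_on_nonempty in \<open>auto intro: F_on_add F_on_scale\<close>)
  then obtain u where u: "u \<in> F_on m E F D" "\<forall>\<phi>\<in>F_on m E F D. E u \<phi> = (\<integral>x. ?f x * \<phi> x \<partial>m)" by blast
  have "(\<lambda>x. - ?f x) \<in> L2_on m D" using L2_scale[OF fL, of "-1"] B(2) by (auto simp: L2_on_def indicator_def)
  then have "(?f, u) \<in> green_operator m E F D" using u by (simp add: green_operator_def generator_def)
  moreover have "\<forall>f\<in>L2_on m D. \<forall>u. (f, u) \<in> green_operator m E F D \<longrightarrow>
        (AE x in m. x \<in> D \<longrightarrow>
           set_integrable m D (\<lambda>y. g x y * f y) \<and> u x = (LINT y:D|m. g x y * f y))"
    using g unfolding green_function_def by (elim conjE)
  ultimately show ?thesis using u fD by blast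
qed

end

text \<open>All the hypotheses on the space. The bounded open sets that occur are balls, and a Green function
  is chosen for each where it is needed.\<close>

locale green = harnack + assumes green: "green_assumption m E F"
begin

lemma
  assumes "green_function m E F D g"
  shows green_sym: "x \<in> D \<Longrightarrow> y \<in> D \<Longrightarrow> x \<noteq> y \<Longrightarrow> g x y = g y x"
    and green_nonneg: "x \<in> D \<Longrightarrow> y \<in> D \<Longrightarrow> x \<noteq> y \<Longrightarrow> 0 \<le> g x y"
    and green_continuous: "continuous_on (D \<times> D - {(x, x) | x. x \<in> D}) (\<lambda>(x, y). g x y)"
    and green_max_principle: "open U \<Longrightarrow> x0 \<in> U \<Longrightarrow> U \<Subset> D \<Longrightarrow>
        (SUP y \<in> D - U. ereal (g x0 y)) = (SUP y \<in> frontier U. ereal (g x0 y))"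
    and green_harmonic: "x \<in> D \<Longrightarrow> harmonic m E F (D - {x}) (g x)"
proof -
  note * = assms[unfolded green_function_def]
  have "\<forall>x\<in>D. \<forall>y\<in>D. x \<noteq> y \<longrightarrow> g x y = g y x \<and> 0 \<le> g x y" using * by (elim conjE)
  then show "x \<in> D \<Longrightarrow> y \<in> D \<Longrightarrow> x \<noteq> y \<Longrightarrow> g x y = g y x"
    "x \<in> D \<Longrightarrow> y \<in> D \<Longrightarrow> x \<noteq> y \<Longrightarrow> 0 \<le> g x y" by auto
  show "continuous_on (D \<times> D - {(x, x) | x. x \<in> D}) (\<lambda>(x, y). g x y)" using * by (elim conjE)
  have "\<forall>x\<^sub>0 U. open U \<and> x\<^sub>0 \<in> U \<and> U \<Subset> D \<longrightarrow>
        (INF y \<in> U - {x\<^sub>0}. ereal (g x\<^sub>0 y)) = (INF y \<in> frontier U. ereal (g x\<^sub>0 y)) \<and>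
        (SUP y \<in> D - U. ereal (g x\<^sub>0 y)) = (SUP y \<in> frontier U. ereal (g x\<^sub>0 y))" using * by (elim conjE)
  then show "open U \<Longrightarrow> x0 \<in> U \<Longrightarrow> U \<Subset> D \<Longrightarrow>
        (SUP y \<in> D - U. ereal (g x0 y)) = (SUP y \<in> frontier U. ereal (g x0 y))" by blast
  have "\<forall>x\<in>D. g x \<in> F_loc m F (D - {x}) \<and> harmonic m E F (D - {x}) (g x)" using * by (elim conjE)
  then show "x \<in> D \<Longrightarrow> harmonic m E F (D - {x}) (g x)" by blast
qed

text \<open>The constant in all Harnack chains for the Green function of \<open>ball z (16 * t)\<close>: they
  join points at mutual distance at most \<open>10 * t\<close> through balls of radius
  \<open>t / (8 * A)\<close>.\<close>

definition green_const :: real where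
  "green_const = chain_const (80 * A)"

lemma green_const_ge_1: "1 \<le> green_const"
  unfolding green_const_def by (rule chain_const_ge_1)

text \<open>The quantity bounded below is twice the Gromov product of \<open>a\<close> and \<open>b\<close>
  seen from the pole \<open>w\<close>; it keeps every almost geodesic from \<open>a\<close> to
  \<open>b\<close> away from \<open>w\<close>.\<close>

lemma green_harnack:
  assumes g: "green_function m E F (ball z (16 * t)) g" and t: "0 < t"
    and w: "w \<in> ball z (16 * t)" and a: "dist z a \<le> 5 * t" and b: "dist z b \<le> 5 * t"
    and gromov: "t / 2 \<le> dist w a + dist w b - dist a b"
  shows "g w a \<le> green_const * g w b"
  unfolding green_const_def
proof (rule harnack_chain_continuous[where U="ball z (16 * t) - {w}" and s="t / (8 * A)"])
  let ?s = "t / (8 * A)"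
  have s: "0 < ?s" "A * ?s = t / 8" "?s \<le> t / 8" using t A by (auto simp: field_simps)
  then show "0 < ?s" by simp
  show "harmonic m E F (ball z (16 * t) - {w}) (g w)" by (rule green_harmonic[OF g w])
  show "\<forall>y\<in>ball z (16 * t) - {w}. 0 \<le> g w y" using green_nonneg[OF g w] by blast
  show "open (ball z (16 * t) - {w})" by (simp add: open_Diff)
  show "ball p (A * ?s) \<subseteq> ball z (16 * t) - {w}"
    if p: "dist a p + dist p b \<le> dist a b + ?s" for p
  proof -
    have "dist w a \<le> dist w p + dist a p" "dist w b \<le> dist w p + dist p b"
      using dist_triangle[of w a p] dist_triangle[of w b p] by (auto simp: dist_commute)
    then have 1: "t / 8 \<le> dist w p" using p gromov s(3) t by linarith
    have "dist z p \<le> dist z a + dist a p" "dist z p \<le> dist z b + dist p b" "dist a b \<le> dist z a + dist z b"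
      using dist_triangle[of z p a] dist_triangle[of z p b] dist_triangle[of a b z] by (auto simp: dist_commute)
    then have 2: "dist z p \<le> 11 * t" using p a b s(3) t by linarith
    show ?thesis
    proof
      fix q assume "q \<in> ball p (A * ?s)"
      then have q: "dist p q < t / 8" using s(2) by simp
      then have "q \<noteq> w" using 1 by (auto simp: dist_commute)
      moreover have "dist z q < 16 * t" using dist_triangle[of z q p] q 2 t by linarith
      ultimately show "q \<in> ball z (16 * t) - {w}" by simp
    qed
  qed
  have "dist a b \<le> 10 * t" using dist_triangle[of a b z] a b by (simp add: dist_commute)
  then show "dist a b \<le> 80 * A * ?s" using A by simp
  show "continuous_on (ball z (16 * t) - {w}) (g w)"
  proof -
    have "continuous_on (ball z (16 * t) - {w}) (\<lambda>y. (\<lambda>(x, y). g x y) (w, y))"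
      by (rule continuous_on_compose2[OF green_continuous[OF g]]) (use w in \<open>auto intro!: continuous_intros\<close>)
    then show ?thesis by simp
  qed
qed

text \<open>If \<open>x\<close> does not lie opposite to \<open>y\<close>, an almost geodesic from
  \<open>x\<close> to \<open>y\<close> avoids \<open>z\<close>. Otherwise symmetry allows the pole
  to be moved: an almost geodesic from \<open>z\<close> to \<open>y\<close> avoids
  \<open>x\<close>, and one from \<open>x\<close> to \<open>z\<close> avoids \<open>y\<close>.\<close>

lemma green_sphere:
  assumes g: "green_function m E F (ball z (16 * t)) g" and t: "0 < t"
    and x: "dist z x = t" and y: "3 * t \<le> dist z y" "dist z y \<le> 4 * t"
  shows "g z x \<le> green_const\<^sup>2 * g z y"
proof -
  let ?D = "ball z (16 * t)"
  have D: "z \<in> ?D" "x \<in> ?D" "y \<in> ?D" using x y t by auto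
  have ne: "z \<noteq> x" "z \<noteq> y" "x \<noteq> y" using x y t by auto
  have G: "1 \<le> green_const" by (rule green_const_ge_1)
  show ?thesis
  proof (cases "dist x y \<le> dist z y + t / 2")
    case True
    then have "g z x \<le> green_const * g z y"
      using x y t D by (intro green_harnack[OF g t]) auto
    also have "\<dots> \<le> green_const * (green_const * g z y)"
      using G green_nonneg[OF g D(1,3) ne(2)] by (intro mult_left_mono) (auto simp: mult_le_cancel_right1)
    finally show ?thesis by (simp add: power2_eq_square)
  next
    case False
    have "g z x = g x z" using green_sym[OF g D(1,2) ne(1)] .
    also have "\<dots> \<le> green_const * g x y"
      using x y t D False by (intro green_harnack[OF g t]) (auto simp: dist_commute)
    also have "g x y = g y x" using green_sym[OF g D(2,3) ne(3)] .
    also have "g y x \<le> green_const * g y z"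
      using x y t D False by (intro green_harnack[OF g t]) (auto simp: dist_commute)
    also have "g y z = g z y" using green_sym[OF g D(3,1)] ne by auto
    finally show ?thesis using G by (simp add: power2_eq_square)
  qed
qed

lemma green_outside:
  assumes g: "green_function m E F (ball z (16 * t)) g" and t: "0 < t"
    and x: "x \<in> ball z (16 * t)" "t \<le> dist z x" and y: "3 * t \<le> dist z y" "dist z y \<le> 4 * t"
  shows "g z x \<le> green_const\<^sup>2 * g z y"
proof -
  have "ball z t \<Subset> ball z (16 * t)" by (rule compactly_in_ball[of _ z t]) (use t in auto)
  then have eq: "(SUP y \<in> ball z (16 * t) - ball z t. ereal (g z y)) = (SUP y \<in> frontier (ball z t). ereal (g z y))"
    using t by (intro green_max_principle[OF g]) auto
  have fr: "dist z q = t" if "q \<in> frontier (ball z t)" for q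
  proof -
    have "closure (ball z t) \<subseteq> cball z t" by (rule closure_minimal) auto
    then show ?thesis using that by (auto simp: frontier_def interior_open)
  qed
  have "ereal (g z x) \<le> (SUP y \<in> ball z (16 * t) - ball z t. ereal (g z y))"
    using x by (intro SUP_upper) auto
  also have "\<dots> \<le> ereal (green_const\<^sup>2 * g z y)"
    unfolding eq using green_sphere[OF g t fr y] by (intro SUP_least) simp
  finally show ?thesis by simp
qed

text \<open>The function \<open>v\<close> is the normalised Green potential of \<open>ball z (t / 2)\<close>.
  A potential is used rather than the Green function itself because it belongs to the form domain
  of \<open>ball z (16 * t)\<close>, that is, it has boundary value \<open>0\<close>.\<close>

lemma bump_exists:
  fixes z y :: 'a
  assumes t: "0 < t" and y: "3 * t \<le> dist z y" "dist z y \<le> 4 * t"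
  shows "\<exists>v\<in>F_on m E F (ball z (16 * t)). (AE x in m. x \<notin> ball z t \<longrightarrow> v x \<le> 1) \<and>
    (AE x in m. x \<in> ball y (t / 4) \<longrightarrow> 1 / green_const ^ 5 \<le> v x) \<and>
    (\<forall>\<phi>\<in>F_on m E F (ball z (16 * t)). (AE x in m. x \<in> ball z t \<longrightarrow> \<phi> x = 0) \<longrightarrow> E v \<phi> = 0)"
proof -
  let ?D = "ball z (16 * t)" and ?B = "ball z (t / 2)" and ?H = green_const
  have H: "1 \<le> ?H" by (rule green_const_ge_1)
  have oD: "bounded ?D" "open ?D" "?D \<noteq> {}" using t by auto
  obtain g where l: "lambda_min m E F ?D > 0" and g: "green_function m E F ?D g"
    using green oD unfolding green_assumption_def by blast
  have "emeasure m ?B \<le> emeasure m (cball z (t / 2))" using sets_m by (intro emeasure_mono) auto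
  also have "\<dots> < \<infinity>" by (intro emeasure_compact compact_cball)
  finally have Bfin: "emeasure m ?B < \<infinity>" .
  have BD: "?B \<subseteq> ?D" using t by auto
  have Bm [measurable]: "?B \<in> sets m" using sets_m by simp
  define \<mu> where "\<mu> = measure m ?B"
  have mu: "0 < \<mu>"
    unfolding \<mu>_def using open_pos[of ?B] Bfin t by (subst measure_def, intro enn2real_positive_iff[THEN iffD2]) auto
  obtain u where u: "u \<in> F_on m E F ?D"
    "\<And>\<phi>. \<phi> \<in> F_on m E F ?D \<Longrightarrow> E u \<phi> = (\<integral>x. indicator ?B x * \<phi> x \<partial>m)"
    "AE x in m. x \<in> ?D \<longrightarrow> set_integrable m ?D (\<lambda>y. g x y * indicator ?B y) \<and>
       u x = (LINT y:?D|m. g x y * indicator ?B y)"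
    using potential_exists[OF l g oD(2) _ BD Bfin] by auto
  have yD: "y \<in> ?D" "z \<in> ?D" using y t by auto
  define G where "G = g z y"
  have G0: "0 \<le> G" unfolding G_def using y t by (intro green_nonneg[OF g yD(2,1)]) auto
  have val: "AE x in m. x \<in> ?D \<and> t \<le> dist z x \<longrightarrow> g z x / ?H * \<mu> \<le> u x \<and> u x \<le> ?H * g z x * \<mu>"
    using u(3)
  proof eventually_elim
    case (elim x)
    show ?case
    proof
      assume x: "x \<in> ?D \<and> t \<le> dist z x"
      have zx: "g x z = g z x" using green_sym[OF g, of x z] x t by auto
      have le: "g x q \<le> ?H * g z x" "g z x \<le> ?H * g x q" if q: "q \<in> ?B" for q
      proof -
        have "dist x z \<le> dist x q + dist q z" by (rule dist_triangle)
        then have "t / 2 \<le> dist x q + dist x z - dist q z" "t / 2 \<le> dist x z + dist x q - dist z q"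
          using x q by (auto simp: dist_commute)
        moreover have "dist z q \<le> 5 * t" "dist z z \<le> 5 * t" using q t by auto
        ultimately show "g x q \<le> ?H * g z x" "g z x \<le> ?H * g x q"
          using green_harnack[OF g t, of x q z] green_harnack[OF g t, of x z q] x zx by auto
      qed
      have int: "integrable m (\<lambda>q. c * indicator ?B q :: real)" for c
        using Bfin by simp
      have cint: "(\<integral>q. c * indicator ?B q \<partial>m) = c * \<mu>" for c by (simp add: \<mu>_def)
      have f: "integrable m (\<lambda>q. indicator ?D q * (g x q * indicator ?B q))"
        "u x = (\<integral>q. indicator ?D q * (g x q * indicator ?B q) \<partial>m)"
        using elim x by (auto simp: set_integrable_def set_lebesgue_integral_def)
      have "u x \<le> (\<integral>q. (?H * g z x) * indicator ?B q \<partial>m)"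
        unfolding f(2) using le(1) BD by (intro integral_mono f(1) int) (auto simp: indicator_def)
      moreover have "(\<integral>q. (g z x / ?H) * indicator ?B q \<partial>m) \<le> u x"
        unfolding f(2) using le(2) BD H
        by (intro integral_mono f(1) int) (auto simp: indicator_def pos_divide_le_eq mult.commute)
      ultimately show "g z x / ?H * \<mu> \<le> u x \<and> u x \<le> ?H * g z x * \<mu>" unfolding cint by simp
    qed
  qed
  have out: "AE x in m. x \<notin> ?D \<longrightarrow> u x = 0" by (rule F_on_outside[OF u(1) oD(2)])
  \<comment> \<open>If \<open>G\<close> were \<open>0\<close>, then \<open>u\<close> would have compact support in \<open>D\<close>, and testing against a cutoff function
    that is constant near this support would contradict locality.\<close>
  have Gpos: "0 < G"
  proof (rule ccontr)
    assume "\<not> 0 < G"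
    then have G: "G = 0" using G0 by simp
    have "AE x in m. x \<notin> cball z t \<longrightarrow> u x = 0"
      using val out
    proof eventually_elim
      case (elim x)
      show ?case
      proof (intro impI)
        assume x: "x \<notin> cball z t"
        show "u x = 0"
        proof (cases "x \<in> ?D")
          case True
          have "g z x \<le> 0" using green_outside[OF g t True _ y] x G by (simp add: G_def)
          moreover have "0 \<le> g z x" using x t by (intro green_nonneg[OF g yD(2) True]) auto
          ultimately show ?thesis using elim(1) True x by auto
        qed (use elim in simp)
      qed
    qed
    moreover obtain \<phi> where phi: "\<phi> \<in> F" "\<phi> \<in> C0 (ball z (3 * t))" "\<And>x. x \<in> cball z (2 * t) \<Longrightarrow> \<phi> x = 1"
      using cutoff_exists[of "2 * t" "3 * t" z] t by auto
    moreover have "AE x in m. x \<notin> closure {x. \<phi> x \<noteq> 0} \<longrightarrow> \<phi> x = 0"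
      by (rule AE_I2) (auto dest: eq_0_outside_support)
    moreover have "AE x in m. x \<in> ball z (2 * t) \<longrightarrow> \<phi> x = 1" using phi(3) by auto
    ultimately have "E \<phi> u = 0"
      using t by (intro E_local_compact[OF _ F_on_F[OF u(1)] compact_support_C0 _ compact_cball[of z t] _ open_ball[of z "2 * t"]])
         auto
    moreover have "ball z (3 * t) \<subseteq> ?D" using t by auto
    then have "\<phi> \<in> F_on m E F ?D" using F_on_mono C0_in_F_on[OF phi(1,2)] by blast
    ultimately have "(\<integral>x. indicator ?B x * \<phi> x \<partial>m) = 0"
      using u(2) E.sym[OF phi(1) F_on_F[OF u(1)]] by simp
    moreover have "(\<lambda>x. indicator ?B x * \<phi> x) = (indicator ?B :: 'a \<Rightarrow> real)"
      using phi(3) t by (auto simp: fun_eq_iff indicator_def)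
    ultimately show False using mu by (simp add: \<mu>_def)
  qed
  \<comment> \<open>One factor \<open>?H\<close> compares the potential with \<open>g z\<close>, and two come from \<open>green_outside\<close>.\<close>
  define a where "a = ?H ^ 3 * G * \<mu>"
  have a: "0 < a" using H Gpos mu by (simp add: a_def)
  define v where "v x = (1 / a) * u x" for x
  have "v \<in> F_on m E F ?D" unfolding v_def by (rule F_on_scale[OF u(1)])
  moreover have "AE x in m. x \<notin> ball z t \<longrightarrow> v x \<le> 1"
    using val out
  proof eventually_elim
    case (elim x)
    show ?case
    proof (intro impI)
      assume x: "x \<notin> ball z t"
      show "v x \<le> 1"
      proof (cases "x \<in> ?D")
        case True
        have "u x \<le> ?H * g z x * \<mu>" using elim(1) True x by auto
        also have "\<dots> \<le> ?H * (?H\<^sup>2 * G) * \<mu>"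
          using green_outside[OF g t True _ y] x H mu
          by (intro mult_right_mono mult_left_mono) (auto simp: G_def)
        also have "\<dots> = a" by (simp add: a_def power2_eq_square power3_eq_cube)
        finally show ?thesis using a by (simp add: v_def)
      qed (use elim in \<open>simp add: v_def\<close>)
    qed
  qed
  moreover have "AE x in m. x \<in> ball y (t / 4) \<longrightarrow> 1 / ?H ^ 5 \<le> v x"
    using val
  proof eventually_elim
    case (elim x)
    show ?case
    proof (intro impI)
      assume x: "x \<in> ball y (t / 4)"
      have d: "dist z y \<le> dist z x + dist y x" "dist z x \<le> dist z y + dist y x"
        using dist_triangle[of z y x] dist_triangle[of z x y] by (auto simp: dist_commute)
      have "G \<le> ?H * g z x" unfolding G_def
        using d x y t by (intro green_harnack[OF g t]) auto
      then have "G / ?H / ?H * \<mu> \<le> g z x / ?H * \<mu>"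
        using H mu by (intro mult_right_mono divide_right_mono) (auto simp: pos_divide_le_eq mult.commute)
      also have "\<dots> \<le> u x" using elim x d y t by auto
      finally have "G / ?H / ?H * \<mu> / a \<le> u x / a" using a by (intro divide_right_mono) auto
      moreover have "G / ?H / ?H * \<mu> / a = 1 / ?H ^ 5"
        using H Gpos mu by (simp add: a_def field_simps power_numeral_reduce)
      ultimately show "1 / ?H ^ 5 \<le> v x" by (simp add: v_def)
    qed
  qed
  moreover have "E v \<phi> = 0" if "\<phi> \<in> F_on m E F ?D" "AE x in m. x \<in> ball z t \<longrightarrow> \<phi> x = 0" for \<phi>
  proof -
    have [measurable]: "\<phi> \<in> borel_measurable m" using F_meas[OF F_on_F[OF that(1)]] .
    have "(\<integral>x. indicator ?B x * \<phi> x \<partial>m) = (\<integral>x. 0 \<partial>m)"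
    proof (rule integral_cong_AE)
      show "AE x in m. indicator ?B x * \<phi> x = 0"
        using that(2) by eventually_elim (use t in \<open>auto simp: indicator_def\<close>)
    qed auto
    then show ?thesis unfolding v_def
      using E.scale_left[OF F_on_F[OF u(1)] F_on_F[OF that(1)], of "1 / a"] u(2)[OF that(1)] by simp
  qed
  ultimately show ?thesis by blast
qed

end

section \<open>Harmonic functions with prescribed values on a set\<close>

context mmd
begin

lemma F_on_max:
  assumes f: "f \<in> F_on m E F D" shows "(\<lambda>x. max (f x) 0) \<in> F_on m E F D"
  by (rule F_on_dominated[OF pos_part(1)[OF F_on_F[OF f]] f]) auto

lemma F_on_sum:
  assumes "finite Z" "\<And>z. z \<in> Z \<Longrightarrow> h z \<in> F_on m E F D"
  shows "(\<lambda>x. \<Sum>z\<in>Z. h z x) \<in> F_on m E F D"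
  using assms
proof (induction Z)
  case empty
  then show ?case using C0_in_F_on[OF zero_F zero_C0] by simp
next
  case (insert z Z)
  then show ?case using F_on_add[of "h z" D "\<lambda>x. \<Sum>z\<in>Z. h z x"] by simp
qed

lemma E_sum_left:
  assumes "finite Z" "\<And>z. z \<in> Z \<Longrightarrow> h z \<in> F" "f \<in> F"
  shows "(\<lambda>x. \<Sum>z\<in>Z. h z x) \<in> F \<and> E (\<lambda>x. \<Sum>z\<in>Z. h z x) f = (\<Sum>z\<in>Z. E (h z) f)"
  using assms
proof (induction Z)
  case empty
  then show ?case using zero_F E.scale_left[OF zero_F, of f 0] by simp
next
  case (insert z Z)
  then show ?case
    using E.add_left[of "h z" "\<lambda>x. \<Sum>z\<in>Z. h z x" f] E.add_closed[of "h z" "\<lambda>x. \<Sum>z\<in>Z. h z x"] by simp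
qed

lemma E_self_zero_imp_AE_zero:
  assumes K: "\<forall>f\<in>F_on m E F D. nsq m f \<le> K * E f f" and f: "f \<in> F_on m E F D" "E f f \<le> 0"
  shows "AE x in m. f x = 0"
proof -
  have "E f f = 0" using E.nonneg[OF F_on_F[OF f(1)]] f(2) by simp
  then have "nsq m f \<le> 0" using K f(1) by force
  then have "nsq m f = 0" using nsq_nonneg by (metis order_antisym)
  then show ?thesis using nsq_eq_0[OF F_L2[OF F_on_F[OF f(1)]]] by blast
qed

text \<open>The function \<open>h\<close> solves the Dirichlet problem: it is harmonic off \<open>A\<close>
  and equals \<open>\<phi>\<close> on \<open>A\<close>. It is \<open>\<phi>\<close> minus its
  projection to the functions vanishing on \<open>A\<close>, modified on a null set so as to be
  nonnegative everywhere.\<close>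

lemma harmonic_extension_exists:
  assumes K: "\<forall>f\<in>F_on m E F D. nsq m f \<le> K * E f f" and A: "A \<in> sets borel"
    and phi: "\<phi> \<in> F_on m E F D" "AE x in m. x \<in> A \<longrightarrow> 0 \<le> \<phi> x"
  shows "\<exists>h\<in>F_on m E F D. (\<forall>x. 0 \<le> h x) \<and> (AE x in m. x \<in> A \<longrightarrow> h x = \<phi> x) \<and>
    (\<forall>f\<in>F_on m E F D. (AE x in m. x \<in> A \<longrightarrow> f x = 0) \<longrightarrow> E h f = 0)"
proof -
  let ?S = "{f \<in> F_on m E F D. AE x in m. x \<in> A \<longrightarrow> f x = 0}"
  have pF: "\<phi> \<in> F" by (rule F_on_F[OF phi(1)])
  have "\<exists>u\<in>?S. \<forall>f\<in>?S. E u f = E \<phi> f"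
  proof (rule riesz[where K=K and L="E \<phi> \<phi>"])
    show "?S \<subseteq> F" using F_on_F by blast
    show "?S \<noteq> {}" using C0_in_F_on[OF zero_F zero_C0] by force
    show "(\<lambda>x. f x + g x) \<in> ?S" if "f \<in> ?S" "g \<in> ?S" for f g
      using that by (auto intro: F_on_add)
    show "(\<lambda>x. c * f x) \<in> ?S" if "f \<in> ?S" for f c using that by (auto intro: F_on_scale)
    show "f \<in> ?S" if f: "f \<in> F" and ap: "\<And>e. e > 0 \<Longrightarrow> \<exists>g\<in>?S. q1 (\<lambda>x. f x - g x) < e" for f
    proof -
      have "f \<in> F_on m E F D" using ap by (intro F_on_closed[OF f]) blast
      moreover have "AE x in m. x \<in> A \<longrightarrow> f x = 0"
        using ap F_on_F by (intro small_nsq_imp_AE_zero[OF f A]) blast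
      ultimately show ?thesis by simp
    qed
    show "E \<phi> (\<lambda>x. f x + g x) = E \<phi> f + E \<phi> g" if "f \<in> ?S" "g \<in> ?S" for f g
      using that pF F_on_F by (auto intro!: E.add_right)
    show "E \<phi> (\<lambda>x. c * f x) = c * E \<phi> f" if "f \<in> ?S" for f c
      using that pF F_on_F by (auto intro!: E.scale_right)
    show "(E \<phi> f)\<^sup>2 \<le> E \<phi> \<phi> * E f f" if "f \<in> ?S" for f
      using that pF F_on_F by (auto intro!: E.cauchy_schwarz)
    show "nsq m f \<le> K * E f f" if "f \<in> ?S" for f using that K by auto
  qed
  then obtain u where u: "u \<in> F_on m E F D" "AE x in m. x \<in> A \<longrightarrow> u x = 0"
    "\<And>f. f \<in> F_on m E F D \<Longrightarrow> AE x in m. x \<in> A \<longrightarrow> f x = 0 \<Longrightarrow> E u f = E \<phi> f" by auto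
  define k where "k x = \<phi> x - u x" for x
  have k: "k \<in> F_on m E F D" unfolding k_def using phi(1) u(1) by (rule F_on_diff)
  have kF: "k \<in> F" by (rule F_on_F[OF k])
  have kA: "AE x in m. x \<in> A \<longrightarrow> k x = \<phi> x" using u(2) by eventually_elim (simp add: k_def)
  have orth: "E k f = 0" if "f \<in> F_on m E F D" "AE x in m. x \<in> A \<longrightarrow> f x = 0" for f
    unfolding k_def using E.diff_left[OF pF F_on_F[OF u(1)] F_on_F[OF that(1)]] u(3)[OF that] by simp
  have nk: "(\<lambda>x. (-1) * k x) \<in> F_on m E F D" by (rule F_on_scale[OF k])
  let ?n = "\<lambda>x. max ((-1) * k x) 0"
  have n: "?n \<in> F_on m E F D" by (rule F_on_max[OF nk])
  have nA: "AE x in m. x \<in> A \<longrightarrow> ?n x = 0" using kA phi(2) by eventually_elim auto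
  have "E ?n ?n \<le> E (\<lambda>x. (-1) * k x) ?n" by (rule E_pos_part_ge[OF F_on_F[OF nk]])
  also have "\<dots> = (-1) * E k ?n" by (rule E.scale_left[OF kF F_on_F[OF n]])
  also have "\<dots> = 0" using orth[OF n nA] by simp
  finally have "AE x in m. ?n x = 0" by (rule E_self_zero_imp_AE_zero[OF K n])
  then have eq: "AE x in m. k x = max (k x) 0" by eventually_elim auto
  let ?h = "\<lambda>x. max (k x) 0"
  have h: "?h \<in> F_on m E F D" by (rule F_on_max[OF k])
  have "AE x in m. x \<in> A \<longrightarrow> ?h x = \<phi> x" using kA eq by eventually_elim auto
  moreover have "E ?h f = 0" if "f \<in> F_on m E F D" "AE x in m. x \<in> A \<longrightarrow> f x = 0" for f
    using E_AE_cong_left[OF kF F_meas[OF F_on_F[OF h]] eq F_on_F[OF that(1)]] orth[OF that] by simp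
  ultimately show ?thesis using h by (intro bexI[of _ ?h]) auto
qed

text \<open>Maximum principle for elements of the form domain of \<open>D\<close> that are orthogonal to all
  those which vanish on \<open>A\<close>.\<close>

lemma harmonic_le_1:
  assumes K: "\<forall>f\<in>F_on m E F D. nsq m f \<le> K * E f f"
    and s: "s \<in> F_on m E F D" "\<And>x. 0 \<le> s x" "AE x in m. x \<in> A \<longrightarrow> s x \<le> 1"
    and orth: "\<And>f. f \<in> F_on m E F D \<Longrightarrow> AE x in m. x \<in> A \<longrightarrow> f x = 0 \<Longrightarrow> E s f = 0"
  shows "AE x in m. s x \<le> 1"
proof -
  have sF: "s \<in> F" by (rule F_on_F[OF s(1)])
  let ?w = "\<lambda>x. min (max (s x) 0) 1" and ?r = "\<lambda>x. max (s x - 1) 0"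
  have w: "?w \<in> F" by (rule truncation(1)[OF sF]) simp
  note r = E_truncation_rest_nonneg[OF sF]
  have rD: "?r \<in> F_on m E F D" by (rule F_on_dominated[OF r(2) s(1)]) auto
  have rA: "AE x in m. x \<in> A \<longrightarrow> ?r x = 0" using s(3) by eventually_elim auto
  have "s = (\<lambda>x. ?w x + ?r x)"
  proof
    fix x show "s x = ?w x + ?r x" using s(2)[of x] by (auto simp: min_def max_def)
  qed
  then have "E s ?r = E ?w ?r + E ?r ?r" by (metis (no_types, lifting) E.add_left[OF w r(2) r(2)])
  then have "E ?r ?r \<le> 0" using orth[OF rD rA] r(1) by simp
  then have "AE x in m. ?r x = 0" by (rule E_self_zero_imp_AE_zero[OF K rD])
  then show ?thesis by eventually_elim auto
qed

text \<open>Comparison principle. The test function is \<open>f = (w - h)\<^sup>+\<close> with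
  \<open>w\<close> the unit contraction of \<open>v\<close>. It vanishes on \<open>A\<close> and
  on \<open>U\<close>, so it is orthogonal to \<open>h\<close> and \<open>v\<close>. As
  \<open>w = v - (v - 1)\<^sup>+ + v\<^sup>-\<close>, locality removes the second term, supported
  in \<open>L \<subseteq> U\<close>, and the third one contributes nonpositively because
  \<open>f\<close> vanishes where \<open>v < 0\<close>.\<close>

lemma harmonic_ge_bump:
  assumes K: "\<forall>f\<in>F_on m E F D. nsq m f \<le> K * E f f"
    and h: "h \<in> F_on m E F D" "\<And>x. 0 \<le> h x" "AE x in m. x \<in> U \<longrightarrow> 1 \<le> h x"
    and orth: "\<And>f. f \<in> F_on m E F D \<Longrightarrow> AE x in m. x \<in> A \<longrightarrow> f x = 0 \<Longrightarrow> E h f = 0"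
    and v: "v \<in> F_on m E F V" "AE x in m. x \<notin> L \<longrightarrow> v x \<le> 1"
      "\<And>f. f \<in> F_on m E F V \<Longrightarrow> AE x in m. x \<in> U \<longrightarrow> f x = 0 \<Longrightarrow> E v f = 0"
    and L: "compact L" "L \<subseteq> U" and U: "open U" and V: "V \<subseteq> D" "open V" "compact (closure V)"
    and A: "AE x in m. x \<in> A \<inter> V \<longrightarrow> 1 \<le> h x"
  shows "AE x in m. min (v x) 1 \<le> h x"
proof -
  have vF: "v \<in> F" and hF: "h \<in> F" using v(1) h(1) F_on_F by auto
  let ?w = "\<lambda>x. min (max (v x) 0) 1"
  have w: "?w \<in> F" by (rule truncation(1)[OF vF]) simp
  let ?f = "\<lambda>x. max (?w x - h x) 0"
  have wh: "(\<lambda>x. ?w x - h x) \<in> F" using w hF by (rule E.diff_closed)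
  have f: "?f \<in> F" by (rule pos_part(1)[OF wh])
  have fle: "0 \<le> ?f x \<and> ?f x \<le> max (v x) 0" for x using h(2)[of x] by (auto simp: min_def max_def)
  have fV: "?f \<in> F_on m E F V" by (rule F_on_dominated[OF f v(1)]) (use fle in auto)
  have fD: "?f \<in> F_on m E F D" using fV F_on_mono[OF V(1)] by blast
  have fU: "AE x in m. x \<in> U \<longrightarrow> ?f x = 0" using h(3) by eventually_elim auto
  have vout: "AE x in m. x \<notin> V \<longrightarrow> v x = 0" by (rule F_on_outside[OF v(1) V(2)])
  have fout: "AE x in m. x \<notin> closure V \<longrightarrow> ?f x = 0"
    using vout
  proof eventually_elim
    case (elim x)
    then show ?case using h(2)[of x] closure_subset[of V] by auto
  qed
  have fA: "AE x in m. x \<in> A \<longrightarrow> ?f x = 0"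
    using vout A
  proof eventually_elim
    case (elim x)
    then show ?case using h(2)[of x] by (cases "x \<in> V") auto
  qed
  have 1: "E h ?f = 0" by (rule orth[OF fD fA])
  have 2: "E v ?f = 0" by (rule v(3)[OF fV fU])
  let ?e = "\<lambda>x. max (v x - 1) 0"
  have e: "?e \<in> F" by (rule E_truncation_rest_nonneg(2)[OF vF])
  have "AE x in m. x \<notin> L \<longrightarrow> ?e x = 0" using v(2) by eventually_elim auto
  then have "E ?f ?e = 0" using E_local_compact[OF f e V(3) fout L(1) _ U L(2) fU] by blast
  then have 3: "E ?e ?f = 0" using E.sym[OF e f] by simp
  let ?n = "\<lambda>x. max ((-1) * v x) 0"
  have n: "?n \<in> F" by (rule pos_part(1)[OF F_mult[OF vF]])
  have fn: "(\<lambda>x. ?f x - ?n x) \<in> F" using f n by (rule E.diff_closed)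
  have "(\<lambda>x. max (?f x - ?n x) 0) = ?f" "(\<lambda>x. max (- (?f x - ?n x)) 0) = ?n"
  proof -
    have "max (?f x - ?n x) 0 = ?f x \<and> max (- (?f x - ?n x)) 0 = ?n x" for x
    proof (cases "0 \<le> v x")
      case True
      then show ?thesis using fle[of x] by auto
    next
      case False
      then have "?f x = 0" using fle[of x] by auto
      then show ?thesis by auto
    qed
    then show "(\<lambda>x. max (?f x - ?n x) 0) = ?f" "(\<lambda>x. max (- (?f x - ?n x)) 0) = ?n" by blast+
  qed
  with E_pos_neg_nonpos[OF fn] have "E ?f ?n \<le> 0" by simp
  then have 4: "E ?n ?f \<le> 0" using E.sym[OF f n] by simp
  have ve: "(\<lambda>x. v x - ?e x) \<in> F" using vF e by (rule E.diff_closed)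
  have weq: "?w = (\<lambda>x. (v x - ?e x) + ?n x)" by (auto simp: fun_eq_iff min_def max_def)
  have "E ?w ?f = E (\<lambda>x. (v x - ?e x) + ?n x) ?f"
    by (rule arg_cong[where f="\<lambda>w. E w ?f", OF weq])
  also have "\<dots> = E v ?f - E ?e ?f + E ?n ?f"
    by (simp only: E.add_left[OF ve n f] E.diff_left[OF vF e f])
  finally have 5: "E ?w ?f = E v ?f - E ?e ?f + E ?n ?f" .
  then have "E (\<lambda>x. ?w x - h x) ?f \<le> 0"
    using E.diff_left[OF w hF f] 1 2 3 4 5 by linarith
  then have "E ?f ?f \<le> 0" using E_pos_part_ge[OF wh] by (rule order_trans[rotated])
  then have "AE x in m. ?f x = 0" by (rule E_self_zero_imp_AE_zero[OF K fD])
  then show ?thesis by eventually_elim auto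
qed

end

section \<open>Separated points on a sphere and metric doubling\<close>

context green
begin

text \<open>A lower bound near the centre of the sphere for the harmonic measure of each obstacle: the value
  near the obstacle, reduced by a Harnack chain of length at most \<open>320 * t\<close> through
  balls of radius \<open>t / (8 * A)\<close>.\<close>

definition hit_const :: real where
  "hit_const = 1 / green_const ^ 5 / chain_const (2560 * A)"

lemma hit_const_pos: "0 < hit_const"
  unfolding hit_const_def using green_const_ge_1 chain_const_ge_1[of "2560 * A"]
  by (intro divide_pos_pos zero_less_power) auto

text \<open>The heart of the argument: \<open>h z\<close> plays the role of the probability, as a function of
  the starting point, that the diffusion reaches the obstacle \<open>cball z (2 * t)\<close>
  before the other obstacles and before leaving \<open>D\<close>. The lower bound on
  \<open>\<rho>\<close> makes the balls \<open>ball z (16 * t)\<close> fit into \<open>D\<close>;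
  the upper bound limits the length of the Harnack chains.\<close>

lemma separated_on_sphere_card:
  fixes x0 :: 'a
  assumes t: "0 < t" and rho: "16 * t \<le> \<rho>" "\<rho> \<le> 320 * t"
    and Z: "finite Z" "\<And>z. z \<in> Z \<Longrightarrow> dist x0 z = \<rho>"
      "\<And>z z'. z \<in> Z \<Longrightarrow> z' \<in> Z \<Longrightarrow> z \<noteq> z' \<Longrightarrow> 40 * t \<le> dist z z'"
  shows "real (card Z) * hit_const \<le> 1"
proof -
  define D where "D = ball x0 (2 * \<rho>)"
  have D: "bounded D" "open D" "D \<noteq> {}" using t rho by (auto simp: D_def)
  then obtain K where K: "\<forall>f\<in>F_on m E F D. nsq m f \<le> K * E f f"
    using green poincare_exists unfolding green_assumption_def by blast
  define B where "B = (\<Union>z\<in>Z. cball z (2 * t))"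
  have clB: "closed B" unfolding B_def using Z(1) by (intro closed_UN) auto
  have far: "z' = z" if "z \<in> Z" "z' \<in> Z" "dist z x + dist z' x < 40 * t" for z z' x
  proof (rule ccontr)
    assume "z' \<noteq> z"
    then have "40 * t \<le> dist z z'" using Z(3) that by blast
    then show False using that(3) dist_triangle[of z z' x] by (simp add: dist_commute)
  qed
  have VD: "ball z (16 * t) \<subseteq> D" if "z \<in> Z" for z
  proof
    fix x assume "x \<in> ball z (16 * t)"
    then show "x \<in> D" using dist_triangle[of x0 x z] Z(2)[OF that] rho by (simp add: D_def)
  qed
  have "\<exists>h\<in>F_on m E F D. (\<forall>x. 0 \<le> h x) \<and> (AE x in m. x \<in> cball z (2 * t) \<longrightarrow> h x = 1) \<and>
      (\<forall>z'\<in>Z - {z}. AE x in m. x \<in> cball z' (2 * t) \<longrightarrow> h x = 0) \<and>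
      (\<forall>f\<in>F_on m E F D. (AE x in m. x \<in> B \<longrightarrow> f x = 0) \<longrightarrow> E h f = 0)"
    if z: "z \<in> Z" for z
  proof -
    obtain \<phi> where phi: "\<phi> \<in> F" "\<phi> \<in> C0 (ball z (16 * t))" "\<And>x. x \<in> cball z (2 * t) \<Longrightarrow> \<phi> x = 1"
      using cutoff_exists[of "2 * t" "16 * t" z] t by auto
    have phiD: "\<phi> \<in> F_on m E F D" using F_on_mono[OF VD[OF z]] C0_in_F_on[OF phi(1,2)] by blast
    have phi0: "\<phi> x = 0" if "z' \<in> Z" "z' \<noteq> z" "x \<in> cball z' (2 * t)" for x z'
      using far[OF z that(1), of x] that t by (intro C0_outside[OF phi(2)]) auto
    have "0 \<le> \<phi> x" if "x \<in> B" for x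
      using that phi(3)[of x] phi0[of _ x] unfolding B_def by (metis UN_E order_refl zero_le_one)
    then obtain h where h: "h \<in> F_on m E F D" "\<forall>x. 0 \<le> h x" "AE x in m. x \<in> B \<longrightarrow> h x = \<phi> x"
      "\<forall>f\<in>F_on m E F D. (AE x in m. x \<in> B \<longrightarrow> f x = 0) \<longrightarrow> E h f = 0"
      using harmonic_extension_exists[OF K borel_closed[OF clB] phiD] by auto
    have "AE x in m. x \<in> cball z (2 * t) \<longrightarrow> h x = 1"
      using h(3) by eventually_elim (use z phi(3) in \<open>auto simp: B_def\<close>)
    moreover have "AE x in m. x \<in> cball z' (2 * t) \<longrightarrow> h x = 0" if "z' \<in> Z - {z}" for z'
      using h(3) by eventually_elim (use that phi0[of z'] in \<open>auto simp: B_def\<close>)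
    ultimately show ?thesis using h by blast
  qed
  then have "\<forall>z\<in>Z. \<exists>h. h \<in> F_on m E F D \<and> (\<forall>x. 0 \<le> h x) \<and>
      (AE x in m. x \<in> cball z (2 * t) \<longrightarrow> h x = 1) \<and>
      (\<forall>z'\<in>Z - {z}. AE x in m. x \<in> cball z' (2 * t) \<longrightarrow> h x = 0) \<and>
      (\<forall>f\<in>F_on m E F D. (AE x in m. x \<in> B \<longrightarrow> f x = 0) \<longrightarrow> E h f = 0)"
    by blast
  from bchoice[OF this] obtain h where hh: "\<forall>z\<in>Z. h z \<in> F_on m E F D \<and> (\<forall>x. 0 \<le> h z x) \<and>
      (AE x in m. x \<in> cball z (2 * t) \<longrightarrow> h z x = 1) \<and>
      (\<forall>z'\<in>Z - {z}. AE x in m. x \<in> cball z' (2 * t) \<longrightarrow> h z x = 0) \<and>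
      (\<forall>f\<in>F_on m E F D. (AE x in m. x \<in> B \<longrightarrow> f x = 0) \<longrightarrow> E (h z) f = 0)" ..
  have h: "h z \<in> F_on m E F D" "0 \<le> h z x" "AE x in m. x \<in> cball z (2 * t) \<longrightarrow> h z x = 1"
    if "z \<in> Z" for z x
    using bspec[OF hh that] by blast+
  have h0: "AE x in m. x \<in> cball z' (2 * t) \<longrightarrow> h z x = 0" if "z \<in> Z" "z' \<in> Z" "z' \<noteq> z" for z z'
    using bspec[OF hh that(1)] that(2,3) by blast
  have orth: "E (h z) f = 0" if "z \<in> Z" "f \<in> F_on m E F D" "AE x in m. x \<in> B \<longrightarrow> f x = 0" for z f
    using bspec[OF hh that(1)] that(2,3) by blast
  have sum_le: "AE x in m. (\<Sum>z\<in>Z. h z x) \<le> 1"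
  proof (rule harmonic_le_1[OF K F_on_sum[OF Z(1) h(1)]])
    show "0 \<le> (\<Sum>z\<in>Z. h z x)" for x using h(2) by (intro sum_nonneg)
    have "AE x in m. \<forall>z\<in>Z. \<forall>z'\<in>Z. x \<in> cball z' (2 * t) \<longrightarrow> h z x = (if z' = z then 1 else 0)"
      using h(3) h0 Z(1) by (intro AE_finite_allI) auto
    then show "AE x in m. x \<in> B \<longrightarrow> (\<Sum>z\<in>Z. h z x) \<le> 1"
    proof eventually_elim
      case (elim x)
      show ?case
      proof
        assume "x \<in> B"
        then obtain z' where z': "z' \<in> Z" "x \<in> cball z' (2 * t)" by (auto simp: B_def)
        then have "(\<Sum>z\<in>Z. h z x) = (\<Sum>z\<in>Z. if z' = z then 1 else 0)"
          using elim by (intro sum.cong) auto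
        then show "(\<Sum>z\<in>Z. h z x) \<le> 1" using z' Z(1) by simp
      qed
    qed
    show "E (\<lambda>x. \<Sum>z\<in>Z. h z x) f = 0"
      if "f \<in> F_on m E F D" "AE x in m. x \<in> B \<longrightarrow> f x = 0" for f
      using E_sum_left[OF Z(1) F_on_F[OF h(1)] F_on_F[OF that(1)]] orth that by simp
  qed
  define s where "s = t / (8 * A)"
  have s: "0 < s" "A * s = t / 8" "s \<le> t / 8" using t A by (auto simp: field_simps s_def)
  have low: "AE x in m. x \<in> ball x0 s \<longrightarrow> hit_const \<le> h z x" if z: "z \<in> Z" for z
  proof -
    \<comment> \<open>The starting point of the chain lies almost on a geodesic from \<open>x0\<close> to \<open>z\<close>, so that the chain from
      \<open>y\<close> to \<open>x0\<close> moves away from all obstacles.\<close>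
    obtain y where y: "dist x0 y = \<rho> - 7 / 2 * t" "dist y z \<le> 4 * t"
      using intermediate_point[of "\<rho> - 7 / 2 * t" x0 z "4 * t"] Z(2)[OF z] t rho by auto
    have y': "7 / 2 * t \<le> dist z y" "dist z y \<le> 4 * t"
      using dist_triangle[of x0 z y] Z(2)[OF z] y by (auto simp: dist_commute)
    have y3: "3 * t \<le> dist z y" using y' t by simp
    obtain v where v: "v \<in> F_on m E F (ball z (16 * t))" "AE x in m. x \<notin> ball z t \<longrightarrow> v x \<le> 1"
      "AE x in m. x \<in> ball y (t / 4) \<longrightarrow> 1 / green_const ^ 5 \<le> v x"
      "\<And>\<phi>. \<phi> \<in> F_on m E F (ball z (16 * t)) \<Longrightarrow> AE x in m. x \<in> ball z t \<longrightarrow> \<phi> x = 0 \<Longrightarrow> E v \<phi> = 0"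
      using bump_exists[OF t y3 y'(2)] by blast
    have "AE x in m. min (v x) 1 \<le> h z x"
    proof (rule harmonic_ge_bump[OF K h(1)[OF z] h(2)[OF z] _ orth[OF z] v(1), where U="ball z (2 * t)" and L="cball z t"])
      show "AE x in m. x \<in> ball z (2 * t) \<longrightarrow> 1 \<le> h z x"
        using h(3)[OF z] by eventually_elim auto
      have "x \<in> cball z (2 * t)" if xB: "x \<in> B" and xV: "x \<in> ball z (16 * t)" for x
      proof -
        obtain z' where z': "z' \<in> Z" "x \<in> cball z' (2 * t)" using xB by (auto simp: B_def)
        then have "z' = z" using far[OF z z'(1), of x] xV t by auto
        then show ?thesis using z' by simp
      qed
      then show "AE x in m. x \<in> B \<inter> ball z (16 * t) \<longrightarrow> 1 \<le> h z x"
        using h(3)[OF z] by (auto elim!: eventually_mono)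
      show "AE x in m. x \<notin> cball z t \<longrightarrow> v x \<le> 1" using v(2) by eventually_elim auto
      show "E v f = 0" if "f \<in> F_on m E F (ball z (16 * t))" "AE x in m. x \<in> ball z (2 * t) \<longrightarrow> f x = 0" for f
      proof (rule v(4)[OF that(1)])
        show "AE x in m. x \<in> ball z t \<longrightarrow> f x = 0" using that(2) by eventually_elim (use t in auto)
      qed
      show "ball z (16 * t) \<subseteq> D" by (rule VD[OF z])
      show "compact (closure (ball z (16 * t)))"
        using compactly_in_ball[of "ball z (16 * t)" z "16 * t" UNIV] by (auto simp: compactly_in_def)
    qed (use t compact_cball in auto)
    with v(3) have near: "AE x in m. x \<in> ball y (t / 4) \<longrightarrow> 1 / green_const ^ 5 \<le> h z x"
    proof eventually_elim
      case (elim x)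
      have "1 / green_const ^ 5 \<le> 1" using one_le_power[OF green_const_ge_1, of 5] by (subst divide_le_eq_1) (use green_const_ge_1 in auto)
      then show ?case using elim by auto
    qed
    have "AE x in m. x \<in> ball x0 s \<longrightarrow> 1 / green_const ^ 5 / chain_const (2560 * A) \<le> h z x"
    proof (rule harnack_chain[where U="D - B" and a=y])
      have oU: "open (D - B)" using D(2) clB by auto
      show "open (D - B)" by (rule oU)
      show "harmonic m E F (D - B) (h z)"
      proof (rule harmonic_of_orthogonal[OF F_on_F[OF h(1)[OF z]] oU])
        fix f assume f: "f \<in> F" "f \<in> C0 (D - B)"
        have "f \<in> F_on m E F D" using F_on_mono[of "D - B" D] C0_in_F_on[OF f] by auto
        then show "E (h z) f = 0" using C0_outside[OF f(2)] by (intro orth[OF z]) auto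
      qed
      show "\<forall>x\<in>D - B. 0 \<le> h z x" using h(2)[OF z] by auto
      show "0 < s" by (rule s)
      show "0 \<le> 1 / green_const ^ 5" using green_const_ge_1 by simp
      show "dist y x0 \<le> 2560 * A * s"
      proof -
        have "2560 * A * s = 320 * t" using s(2) by simp
        then show ?thesis using y(1) rho t by (simp add: dist_commute)
      qed
      show "\<not> (AE x in m. x \<in> ball y s \<longrightarrow> h z x < 1 / green_const ^ 5)"
      proof
        assume "AE x in m. x \<in> ball y s \<longrightarrow> h z x < 1 / green_const ^ 5"
        with near have "AE x in m. x \<notin> ball y s" by eventually_elim (use s t in auto)
        then show False using open_not_AE_avoided[of "ball y s" y] s by auto
      qed
      fix p assume p: "dist y p + dist p x0 \<le> dist y x0 + s"
      have px: "dist x0 p \<le> \<rho>" using p y(1) s(3) t zero_le_dist[of y p] dist_commute[of y x0] dist_commute[of p x0]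
        by linarith
      have pz: "3 * t \<le> dist z' p" if z': "z' \<in> Z" for z'
      proof -
        have "7 / 2 * t \<le> dist z' y"
        proof (cases "z' = z")
          case True
          then show ?thesis using y' by simp
        next
          case False
          then show ?thesis using far[OF z z', of y] y' t by fastforce
        qed
        moreover have "dist z' y \<le> dist z' p + dist y p" "dist x0 z' \<le> dist z' p + dist p x0"
          using dist_triangle[of z' y p] dist_triangle[of x0 z' p] by (auto simp: dist_commute)
        ultimately show ?thesis using p y(1) Z(2)[OF z'] s(3) t by (simp add: dist_commute)
      qed
      show "ball p (A * s) \<subseteq> D - B"
      proof
        fix q assume "q \<in> ball p (A * s)"
        then have q: "dist p q < t / 8" using s(2) by simp
        have "q \<in> D" using dist_triangle[of x0 q p] q px rho t by (simp add: D_def)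
        moreover have "q \<notin> cball z' (2 * t)" if "z' \<in> Z" for z'
          using dist_triangle[of z' p q] q pz[OF that] t by (simp add: dist_commute)
        ultimately show "q \<in> D - B" by (auto simp: B_def)
      qed
    qed
    then show ?thesis by (simp add: hit_const_def)
  qed
  have "AE x in m. \<forall>z\<in>Z. x \<in> ball x0 s \<longrightarrow> hit_const \<le> h z x"
    using low Z(1) by (intro AE_finite_allI) auto
  with sum_le have "AE x in m. x \<in> ball x0 s \<longrightarrow> real (card Z) * hit_const \<le> 1"
  proof eventually_elim
    case (elim x)
    show ?case
    proof
      assume x: "x \<in> ball x0 s"
      have "real (card Z) * hit_const = (\<Sum>z\<in>Z. hit_const)" by simp
      also have "\<dots> \<le> (\<Sum>z\<in>Z. h z x)" using elim x by (intro sum_mono) auto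
      finally show "real (card Z) * hit_const \<le> 1" using elim by simp
    qed
  qed
  then show ?thesis
    using open_not_AE_avoided[of "ball x0 s" x0] s(1) by (cases "real (card Z) * hit_const \<le> 1") auto
qed

lemma finite_sphere_net:
  fixes x0 :: 'a
  assumes t: "0 < t" and rho: "16 * t \<le> \<rho>" "\<rho> \<le> 320 * t"
  shows "\<exists>Z. finite Z \<and> card Z \<le> nat \<lfloor>1 / hit_const\<rfloor> \<and> (\<forall>y. dist x0 y = \<rho> \<longrightarrow> (\<exists>z\<in>Z. dist z y < 40 * t))"
proof -
  define P where "P Z \<longleftrightarrow> finite Z \<and> (\<forall>z\<in>Z. dist x0 z = \<rho>) \<and>
    (\<forall>z\<in>Z. \<forall>z'\<in>Z. z \<noteq> z' \<longrightarrow> 40 * t \<le> dist z z')" for Z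
  let ?N = "nat \<lfloor>1 / hit_const\<rfloor>"
  have bound: "card Z \<le> ?N" if "P Z" for Z
  proof -
    have "real (card Z) * hit_const \<le> 1"
      using that unfolding P_def by (intro separated_on_sphere_card[OF t rho]) auto
    then have "real (card Z) \<le> 1 / hit_const" using hit_const_pos by (simp add: field_simps)
    then show ?thesis by (rule le_nat_floor)
  qed
  have P0: "P {}" by (simp add: P_def)
  have "\<forall>Z. P Z \<longrightarrow> card Z < ?N + 1" using bound by (simp add: less_Suc_eq_le)
  from ex_has_greatest_nat[of P, OF P0 this] obtain Z
    where Z: "P Z" "\<And>Z'. P Z' \<Longrightarrow> card Z' \<le> card Z" by auto
  have "\<exists>z\<in>Z. dist z y < 40 * t" if y: "dist x0 y = \<rho>" for y
  proof (rule ccontr)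
    assume "\<not> (\<exists>z\<in>Z. dist z y < 40 * t)"
    then have far: "40 * t \<le> dist z y" if "z \<in> Z" for z using that by force
    then have "y \<notin> Z" using t by force
    have "P (insert y Z)" using Z(1) far y unfolding P_def by (auto simp: dist_commute)
    from Z(2)[OF this] show False using \<open>y \<notin> Z\<close> Z(1) by (simp add: P_def)
  qed
  moreover have "finite Z" using Z(1) by (simp add: P_def)
  ultimately show ?thesis using bound[OF Z(1)] by (intro exI[of _ Z]) simp
qed

text \<open>A point at distance between \<open>R / 2\<close> and \<open>R\<close> from \<open>x\<close> is
  within \<open>R / 8\<close> of one of the four spheres of radius \<open>k R / 8\<close> with
  \<open>4 \<le> k \<le> 7\<close>, each of which has a net of mesh \<open>R / 8 = 40 t\<close>
  for \<open>t = R / 320\<close>.\<close>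

lemma ball_cover:
  fixes x :: 'a
  assumes R: "0 < R"
  shows "\<exists>Z. finite Z \<and> card Z \<le> 1 + 4 * nat \<lfloor>1 / hit_const\<rfloor> \<and> ball x R \<subseteq> (\<Union>c\<in>Z. ball c (R / 2))"
proof -
  let ?N = "nat \<lfloor>1 / hit_const\<rfloor>"
  let ?\<rho> = "\<lambda>k::nat. real k * R / 8"
  have "\<exists>Z. finite Z \<and> card Z \<le> ?N \<and> (\<forall>y. dist x y = ?\<rho> k \<longrightarrow> (\<exists>z\<in>Z. dist z y < R / 8))"
    if "k \<in> {4..7}" for k
  proof -
    have "4 * R \<le> real k * R" "real k * R \<le> 7 * R" using that R by (auto intro: mult_right_mono)
    then show ?thesis using finite_sphere_net[of "R / 320" "?\<rho> k" x] R by simp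
  qed
  then obtain Z where Z: "\<And>k. k \<in> {4..7} \<Longrightarrow> finite (Z k) \<and> card (Z k) \<le> ?N \<and>
      (\<forall>y. dist x y = ?\<rho> k \<longrightarrow> (\<exists>z\<in>Z k. dist z y < R / 8))" by metis
  define W where "W = insert x (\<Union>k\<in>{4..7}. Z k)"
  have "finite W" unfolding W_def using Z by auto
  moreover have "card W \<le> 1 + 4 * ?N"
  proof -
    have "card W \<le> Suc (card (\<Union>k\<in>{4..7}. Z k))" unfolding W_def by (rule card_insert_le_m1) auto
    also have "card (\<Union>k\<in>{4..7}. Z k) \<le> (\<Sum>k\<in>{4..7}. card (Z k))" by (rule card_UN_le) simp
    also have "\<dots> \<le> (\<Sum>k\<in>{4..7::nat}. ?N)" using Z by (intro sum_mono) blast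
    finally show ?thesis by simp
  qed
  moreover have "ball x R \<subseteq> (\<Union>c\<in>W. ball c (R / 2))"
  proof
    fix y assume y: "y \<in> ball x R"
    show "y \<in> (\<Union>c\<in>W. ball c (R / 2))"
    proof (cases "dist x y < R / 2")
      case True
      then show ?thesis by (auto simp: W_def)
    next
      case False
      define k where "k = nat \<lfloor>8 * dist x y / R\<rfloor>"
      have q: "4 \<le> 8 * dist x y / R" "8 * dist x y / R < 8" using False y R by (auto simp: field_simps)
      then have k: "k \<in> {4..7}" unfolding k_def by (auto simp: le_nat_iff le_floor_iff) linarith
      have "real k \<le> 8 * dist x y / R" "8 * dist x y / R < real k + 1"
        using q unfolding k_def by linarith+
      then have "?\<rho> k \<le> dist x y" "dist x y < ?\<rho> k + R / 8" using R by (auto simp: field_simps)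
      then obtain p where p: "dist x p = ?\<rho> k" "dist p y \<le> R / 8"
        using intermediate_point[of "?\<rho> k" x y "R / 8"] R by auto
      then obtain z where z: "z \<in> Z k" "dist z p < R / 8" using Z[OF k] by blast
      have "dist z y < R / 2" using dist_triangle[of z y p] z p R by simp
      then show ?thesis using z(1) k by (auto simp: W_def)
    qed
  qed
  ultimately show ?thesis by blast
qed

end

theorem theorem3p11:
  fixes m :: "'a::polish_space measure"
    and E :: "('a \<Rightarrow> real) \<Rightarrow> ('a \<Rightarrow> real) \<Rightarrow> real"
    and F :: "('a \<Rightarrow> real) set"
  assumes "length_mmd_space m E F"
    and "green_assumption m E F"
    and "EHI m E F"
  shows "\<exists>M::nat. \<forall>(x::'a) (R::real). R > 0 \<longrightarrow>
           (\<exists>C. finite C \<and> card C \<le> M \<and> ball x R \<subseteq> (\<Union>c\<in>C. ball c (R / 2)))"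
proof -
  obtain A C where "1 < A" "1 < C" and
    "\<forall>x R h. 0 < R \<longrightarrow> harmonic m E F (ball x (A * R)) h \<longrightarrow> (\<forall>y\<in>ball x (A * R). 0 \<le> h y) \<longrightarrow>
       esssup (restrict_space m (ball x R)) (\<lambda>y. ereal (h y))
         \<le> ereal C * essinf (restrict_space m (ball x R)) (\<lambda>y. ereal (h y))"
    using assms(3) unfolding EHI_def by blast
  then interpret green m E F A C
    using assms by unfold_locales auto
  show ?thesis using ball_cover by blast
qed

end
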